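(* Let $d\ge1$, let $V$ be a real inner product space of finite dimension $n$ and $\bar V_d=\mathbb{R}^d\times V$. The parametrized mapping space signature $\bar\Phi:(\mathrm{Lip}_J(\square^d,V),\mu_\infty)\to\mathbf{H}_d((\bar V_d))$ is continuous. Moreover, if $\mathbf{x},\mathbf{y}\in\mathrm{Lip}_J(\square^d,V)$, $L>\max\{\|\hat d\mathbf{x}\|_\infty,\|\hat d\mathbf{y}\|_\infty,1\}$ and $\epsilon>\mu_\infty(\mathbf{x},\mathbf{y})$, then for every $m\ge1$ and every $(\mathbf{P},\boldsymbol\pi)\in W^m\times\Sigma_m^d$, $$\left|\bar\Phi_m^{\mathbf{P},\boldsymbol\pi}(\mathbf{x})-\bar\Phi_m^{\mathbf{P},\boldsymbol\pi}(\mathbf{y})\right|<\frac{mL^{m-1}}{(m!)^d}\,\epsilon .$$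
   Context: Notation: $\square^d=[0,1]^d$, $[k]=\{1,\dots,k\}$, $\Sigma_m$ is the symmetric group on $[m]$, $e_{v,1},\dots,e_{v,n}$ is an orthonormal basis of $V$ and $e_{u,1},\dots,e_{u,d}$ one of $\mathbb{R}^d$. $\mathcal{O}_{d,n}$ is the set of order-preserving injections $P:[d]\to[n]$. For a Lipschitz map $\mathbf{x}=(x_1,\dots,x_n):\square^d\to V$ (differentiable a.e.), $J[\mathbf{x}_P](\mathbf{s})=\det(\partial x_{P(i)}/\partial s_j(\mathbf{s}))_{i,j\in[d]}$, $\hat d\mathbf{x}=(J[\mathbf{x}_P])_{P\in\mathcal{O}_{d,n}}\in L^\infty(\square^d,\Lambda^dV)$ in the orthonormal basis $e_{v,P(1)}\wedge\dots\wedge e_{v,P(d)}$ of $\Lambda^dV$, and $\|\cdot\|_\infty$ is the $L^\infty$ norm with respect to the Euclidean norm. Lipschitz maps are Jacobian equivalent if $\hat d\mathbf{x}=\hat d\mathbf{y}$ in $L^\infty$; $\mathrm{Lip}_J(\square^d,V)$ is the set of equivalence classes, with metric $\mu_\infty(\mathbf{x},\mathbf{y})=\|\hat d\mathbf{x}-\hat d\mathbf{y}\|_\infty$. For $\pi\in\Sigma_m$, $\Delta^m_\pi=\{0\le t_{\pi(1)}<\dots<t_{\pi(m)}\le1\}$; for $\boldsymbol\pi=(\pi_1,\dots,\pi_d)\in\Sigma_m^d$, $D^m_{\boldsymbol\pi}=\prod_{j=1}^d\Delta^m_{\pi_j}$ with coordinates $\mathbf{t}=(t_{i,j})_{i\in[m],j\in[d]}$,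 $(t_{1,j},\dots,t_{m,j})\in\Delta^m_{\pi_j}$, $\mathbf{t}_i=(t_{i,1},\dots,t_{i,d})$. For a finite-dimensional inner product space $E$: $\mathbf{T}_d^{(0)}(E)=\mathbb{R}$, $\mathbf{T}_d^{(m)}(E)=\prod_{\boldsymbol\pi\in\Sigma_m^d}(\Lambda^dE)^{\otimes m}$, and $\mathbf{H}_d((E))=\{(\mathbf{r}_m)_{m\ge0}\in\prod_m\mathbf{T}_d^{(m)}(E):\sum_m\|\mathbf{r}_m\|^2<\infty\}$, a Hilbert space. Let $W=\{U\}\cup\mathcal{O}_{d,n}$, where $U$ stands for the basis element $e^U=e_{u,1}\wedge\dots\wedge e_{u,d}$ and $P\in\mathcal{O}_{d,n}$ for $e^P=e_{v,P(1)}\wedge\dots\wedge e_{v,P(d)}$ of $\Lambda^d\bar V_d$. With $\bar{\mathbf{x}}(\mathbf{s})=(\mathbf{s},\mathbf{x}(\mathbf{s}))$ one has $J[\bar{\mathbf{x}}_U]=1$ and $J[\bar{\mathbf{x}}_P]=J[\mathbf{x}_P]$. $\bar\Phi(\mathbf{x})\in\mathbf{H}_d((\bar V_d))$ has level $0$ component $1$ and, for $m\ge1$, $\mathbf{P}=(P_1,\dots,P_m)\in W^m$, $\boldsymbol\pi\in\Sigma_m^d$, coordinate $\bar\Phi_m^{\mathbf{P},\boldsymbol\pi}(\mathbf{x})=\int_{D^m_{\boldsymbol\pi}}\prod_{i=1}^mJ[\bar{\mathbf{x}}_{P_i}](\mathbf{t}_i)\,d\mathbf{t}$ along $e^{P_1}\otimes\dots\otimes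 e^{P_m}$ in the $\boldsymbol\pi$ factor; all coordinates whose form index involves a basis element outside $W$ are $0$. $\bar\Phi$ is well defined on Jacobian equivalence classes. *)

theory Defs
  imports "HOL-Analysis.Analysis" "HOL-Probability.Essential_Supremum" "HOL-Combinatorics.Permutations"
begin

text \<open>
  Conventions.  The index set \<open>[d]\<close> is a finite linearly ordered type \<open>'d\<close>, so that \<open>d = CARD('d) \<ge> 1\<close>
  and \<open>\<real>\<^sup>d\<close> is \<^typ>\<open>real^'d\<close>, with its standard basis as the basis \<open>e\<^sub>u\<close>; the cube is \<^term>\<open>cbox 0 (1 :: real^'d)\<close>.
  The inner product space \<open>V\<close> is a type of class \<^class>\<open>real_inner\<close> with an orthonormal basis
  \<open>e 1, \<dots>, e n\<close>, \<open>n = 0\<close> being allowed.  Elements of \<open>\<Lambda>\<^sup>dE\<close> and of its tensor powers are given by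
  their coordinates in the orthonormal bases induced by an orthonormal basis of \<open>E\<close>.
\<close>

definition orthonormal_basis :: "(nat \<Rightarrow> 'v::real_inner) \<Rightarrow> nat \<Rightarrow> bool" where
  "orthonormal_basis e n \<longleftrightarrow>
     (\<forall>i\<in>{1..n}. \<forall>j\<in>{1..n}. e i \<bullet> e j = (if i = j then 1 else 0)) \<and> span (e ` {1..n}) = UNIV"

definition ord_inj :: "nat \<Rightarrow> ('d::{finite,linorder} \<Rightarrow> nat) set" where
  "ord_inj n = {P. strict_mono P \<and> range P \<subseteq> {1..n}}"

definition Lip :: "(real^'d::finite \<Rightarrow> 'v::real_inner) set" where
  "Lip = {x. \<exists>C. C-lipschitz_on (cbox 0 1) x}"

text \<open>
  The difference quotients only use points of the cube, so that the values of \<open>f\<close> outside the cube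
  are irrelevant.  Where the partial derivative does not exist the value is arbitrary; for Lipschitz
  maps this is a null set.
\<close>
definition partial_deriv :: "(real^'d::finite \<Rightarrow> real) \<Rightarrow> 'd \<Rightarrow> real^'d \<Rightarrow> real" where
  "partial_deriv f j s =
     vector_derivative (\<lambda>h. f (s + h *\<^sub>R axis j 1))
       (at 0 within {h. s + h *\<^sub>R axis j 1 \<in> cbox 0 1})"

definition jac_minor ::
    "('k \<Rightarrow> 'e::real_inner) \<Rightarrow> (real^'d::finite \<Rightarrow> 'e) \<Rightarrow> ('d \<Rightarrow> 'k) \<Rightarrow> real^'d \<Rightarrow> real" where
  "jac_minor b f Q s = det (\<chi> i j. partial_deriv (\<lambda>s. f s \<bullet> b (Q i)) j s)"

definition Linf_norm :: "nat \<Rightarrow> (real^'d::{finite,linorder} \<Rightarrow> ('d \<Rightarrow> nat) \<Rightarrow> real) \<Rightarrow> real" where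
  "Linf_norm n \<omega> =
     real_of_ereal (esssup (lebesgue_on (cbox 0 1)) (\<lambda>s. ereal (L2_set (\<omega> s) (ord_inj n))))"

definition dhat ::
    "(nat \<Rightarrow> 'v::real_inner) \<Rightarrow> (real^'d::{finite,linorder} \<Rightarrow> 'v) \<Rightarrow> (real, 'd) vec \<Rightarrow> ('d \<Rightarrow> nat) \<Rightarrow> real" where
  "dhat e x = (\<lambda>s P. jac_minor e x P s)"

definition jac_equiv ::
    "(nat \<Rightarrow> 'v::real_inner) \<Rightarrow> nat \<Rightarrow> (real^'d::{finite,linorder} \<Rightarrow> 'v) rel" where
  "jac_equiv e n = {(x, y). x \<in> Lip \<and> y \<in> Lip \<and>
     (AE s in lebesgue_on (cbox 0 1). \<forall>P\<in>ord_inj n. dhat e x s P = dhat e y s P)}"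

definition LipJ ::
    "(nat \<Rightarrow> 'v::real_inner) \<Rightarrow> nat \<Rightarrow> (real^'d::{finite,linorder} \<Rightarrow> 'v) set set" where
  "LipJ e n = Lip // jac_equiv e n"

text \<open>
  Maps on classes are lifted with \<^const>\<open>the_elem\<close>; independence of the representative is shown in
  \<open>dhat_norm_eq\<close>, \<open>mu_inf_eq\<close> and \<open>bar_Phi_eq\<close> below.
\<close>
definition dhat_norm ::
    "(nat \<Rightarrow> 'v::real_inner) \<Rightarrow> nat \<Rightarrow> (real^'d::{finite,linorder} \<Rightarrow> 'v) set \<Rightarrow> real" where
  "dhat_norm e n X = the_elem ((\<lambda>x. Linf_norm n (dhat e x)) ` X)"

text \<open>The locale \<^locale>\<open>Metric_space\<close> asks for nonnegativity and symmetry outside of the carrier, too.\<close>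
definition mu_inf ::
    "(nat \<Rightarrow> 'v::real_inner) \<Rightarrow> nat \<Rightarrow> (real^'d::{finite,linorder} \<Rightarrow> 'v) set
      \<Rightarrow> ((real, 'd) vec \<Rightarrow> 'v) set \<Rightarrow> real" where
  "mu_inf e n X Y =
     (if X \<in> LipJ e n \<and> Y \<in> LipJ e n
      then the_elem ((\<lambda>(x, y). Linf_norm n (\<lambda>s P. dhat e x s P - dhat e y s P)) ` (X \<times> Y))
      else 0)"

text \<open>
  For \<open>B\<close> indexing an orthonormal basis of \<open>\<Lambda>\<^sup>dE\<close>, the pairs \<open>(P, \<pi>)\<close> below index an orthonormal basis of
  the product over \<open>\<pi>\<close> of the \<open>m\<close>-fold tensor powers of \<open>\<Lambda>\<^sup>dE\<close>.  There is exactly one index for \<open>m = 0\<close>.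
\<close>
type_synonym ('d, 'f) tensor_index = "(nat \<Rightarrow> 'f) \<times> ('d \<Rightarrow> nat \<Rightarrow> nat)"

definition tensor_indices :: "'f set \<Rightarrow> nat \<Rightarrow> ('d::finite, 'f) tensor_index set" where
  "tensor_indices B m = ({1..m} \<rightarrow>\<^sub>E B) \<times> {\<pi>. \<forall>j. \<pi> j permutes {1..m}}"

definition tensors :: "'f set \<Rightarrow> nat \<Rightarrow> (('d::finite, 'f) tensor_index \<Rightarrow> real) set" where
  "tensors B m = {r. \<forall>a. a \<notin> tensor_indices B m \<longrightarrow> r a = 0}"

definition hilb :: "'f set \<Rightarrow> (nat \<Rightarrow> ('d::finite, 'f) tensor_index \<Rightarrow> real) set" where
  "hilb B = {r. (\<forall>m. r m \<in> tensors B m) \<and> (\<lambda>m. (L2_set (r m) (tensor_indices B m))\<^sup>2) summable_on UNIV}"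

definition hilb_dist ::
    "'f set \<Rightarrow> (nat \<Rightarrow> ('d::finite, 'f) tensor_index \<Rightarrow> real) \<Rightarrow>
      (nat \<Rightarrow> ('d, 'f) tensor_index \<Rightarrow> real) \<Rightarrow> real" where
  "hilb_dist B r r' = sqrt (\<Sum>\<^sub>\<infinity>m. (L2_set (\<lambda>a. r m a - r' m a) (tensor_indices B m))\<^sup>2)"

definition bar_basis :: "(nat \<Rightarrow> 'v::real_inner) \<Rightarrow> 'd::finite + nat \<Rightarrow> (real^'d) \<times> 'v" where
  "bar_basis e k = (case k of Inl j \<Rightarrow> (axis j 1, 0) | Inr i \<Rightarrow> (0, e i))"

definition bar_map :: "(real^'d::finite \<Rightarrow> 'v) \<Rightarrow> real^'d \<Rightarrow> (real^'d) \<times> 'v" where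
  "bar_map x s = (s, x s)"

text \<open>The ordering \<open>e\<^sub>u\<^sub>,\<^sub>1, \<dots>, e\<^sub>u\<^sub>,\<^sub>d, e\<^sub>v\<^sub>,\<^sub>1, \<dots>, e\<^sub>v\<^sub>,\<^sub>n\<close> of the basis of \<open>\<real>\<^sup>d \<times> V\<close>.\<close>
fun bar_less :: "'d::linorder + nat \<Rightarrow> 'd + nat \<Rightarrow> bool" where
  "bar_less (Inl i) (Inl j) = (i < j)"
| "bar_less (Inl i) (Inr j) = True"
| "bar_less (Inr i) (Inl j) = False"
| "bar_less (Inr i) (Inr j) = (i < j)"

definition bar_forms :: "nat \<Rightarrow> ('d::{finite,linorder} \<Rightarrow> 'd + nat) set" where
  "bar_forms n = {Q. monotone (<) bar_less Q \<and> range Q \<subseteq> UNIV <+> {1..n}}"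

text \<open>Here \<^const>\<open>Inl\<close> is the index \<open>U\<close>, and \<open>Inr \<circ> P\<close> is the index of \<open>e\<^sub>v\<^sub>,\<^sub>P\<^sub>(\<^sub>1\<^sub>) \<and> \<dots> \<and> e\<^sub>v\<^sub>,\<^sub>P\<^sub>(\<^sub>d\<^sub>)\<close>.\<close>
definition W :: "nat \<Rightarrow> ('d::{finite,linorder} \<Rightarrow> 'd + nat) set" where
  "W n = insert Inl ((\<lambda>P. Inr \<circ> P) ` ord_inj n)"

definition order_simplex :: "nat \<Rightarrow> (nat \<Rightarrow> nat) \<Rightarrow> (nat \<Rightarrow> real) set" where
  "order_simplex m \<sigma> = {\<tau>. 0 \<le> \<tau> (\<sigma> 1) \<and> strict_mono_on {1..m} (\<tau> \<circ> \<sigma>) \<and> \<tau> (\<sigma> m) \<le> 1}"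

definition sig_domain :: "nat \<Rightarrow> ('d::finite \<Rightarrow> nat \<Rightarrow> nat) \<Rightarrow> (nat \<Rightarrow> real^'d) set" where
  "sig_domain m \<pi> = {t \<in> {1..m} \<rightarrow>\<^sub>E UNIV. \<forall>j. (\<lambda>i. t i $ j) \<in> order_simplex m (\<pi> j)}"

definition sig_coord ::
    "(nat \<Rightarrow> 'v::real_inner) \<Rightarrow> (real^'d::{finite,linorder} \<Rightarrow> 'v) \<Rightarrow> nat \<Rightarrow>
      ('d, 'd \<Rightarrow> 'd + nat) tensor_index \<Rightarrow> real" where
  "sig_coord e x m = (\<lambda>(P, \<pi>). set_lebesgue_integral (Pi\<^sub>M {1..m} (\<lambda>_. lborel)) (sig_domain m \<pi>)
     (\<lambda>t. \<Prod>i\<in>{1..m}. jac_minor (bar_basis e) (bar_map x) (P i) (t i)))"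

definition bar_sig ::
    "(nat \<Rightarrow> 'v::real_inner) \<Rightarrow> nat \<Rightarrow> (real^'d::{finite,linorder} \<Rightarrow> 'v) \<Rightarrow> nat \<Rightarrow>
      ('d, 'd \<Rightarrow> 'd + nat) tensor_index \<Rightarrow> real" where
  "bar_sig e n x m a =
     (if a \<in> tensor_indices (W n) m then if m = 0 then 1 else sig_coord e x m a else 0)"

definition bar_Phi ::
    "(nat \<Rightarrow> 'v::real_inner) \<Rightarrow> nat \<Rightarrow> (real^'d::{finite,linorder} \<Rightarrow> 'v) set \<Rightarrow> nat \<Rightarrow>
      ('d, 'd \<Rightarrow> 'd + nat) tensor_index \<Rightarrow> real" where
  "bar_Phi e n X = the_elem (bar_sig e n ` X)"

lemma cube_line:
  fixes s :: "real^'d::finite"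
  assumes "s \<in> cbox 0 1"
  shows "s + h *\<^sub>R axis j 1 \<in> cbox 0 1 \<longleftrightarrow> - (s $ j) \<le> h \<and> h \<le> 1 - s $ j"
proof -
  have "(s + h *\<^sub>R axis j 1) $ i = (if i = j then s $ j + h else s $ i)" for i
    by (simp add: axis_def)
  with assms show ?thesis
    unfolding mem_box_cart by (auto split: if_splits)
qed

lemma cube_line_ivl:
  fixes s :: "real^'d::finite"
  assumes "s \<in> cbox 0 1"
  shows "{h. s + h *\<^sub>R axis j 1 \<in> cbox 0 1} = {- (s $ j)..1 - s $ j}"
  using cube_line[OF assms] by auto

lemma cube_nth: "s \<in> cbox 0 1 \<Longrightarrow> 0 \<le> s $ j \<and> s $ j \<le> 1" for s :: "real^'d::finite"
  by (simp add: mem_box_cart)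

lemma partial_deriv_eqI:
  fixes s :: "real^'d::finite"
  assumes "s \<in> cbox 0 1"
    and "((\<lambda>h. f (s + h *\<^sub>R axis j 1)) has_vector_derivative D)
           (at 0 within {h. s + h *\<^sub>R axis j 1 \<in> cbox 0 1})"
  shows "partial_deriv f j s = D"
  using assms(2) cube_nth[OF assms(1), of j]
  unfolding partial_deriv_def cube_line_ivl[OF assms(1)] box_real(2)[symmetric]
  by (intro vector_derivative_within_cbox) auto

lemma partial_deriv_nth:
  fixes s :: "real^'d::finite"
  assumes "s \<in> cbox 0 1"
  shows "partial_deriv (\<lambda>s. s $ i) j s = (if i = j then 1 else 0)"
proof (rule partial_deriv_eqI[OF assms])
  show "((\<lambda>h. (s + h *\<^sub>R axis j 1) $ i) has_vector_derivative (if i = j then 1 else 0))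
     (at 0 within {h. s + h *\<^sub>R axis j 1 \<in> cbox 0 1})"
    by (cases "i = j") (auto simp: axis_def intro!: derivative_eq_intros)
qed

lemma jac_minor_bar_U:
  fixes s :: "real^'d::{finite,linorder}"
  assumes "s \<in> cbox 0 1"
  shows "jac_minor (bar_basis e) (bar_map x) Inl s = 1"
proof -
  have "(\<lambda>s. bar_map x s \<bullet> bar_basis e (Inl i)) = (\<lambda>s. s $ i)" for i :: 'd
    by (simp add: bar_map_def bar_basis_def inner_axis)
  then show ?thesis
    by (simp add: jac_minor_def partial_deriv_nth[OF assms] flip: mat_def)
qed

lemma jac_minor_bar_P:
  "jac_minor (bar_basis e) (bar_map x) (Inr \<circ> P) s = jac_minor e x P s"
  by (simp add: jac_minor_def bar_map_def bar_basis_def)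

lemma W_subset_bar_forms: "W n \<subseteq> bar_forms n"
  by (fastforce simp: W_def bar_forms_def ord_inj_def monotone_on_def strict_mono_def)

lemma finite_ord_inj: "finite (ord_inj n)"
proof (rule finite_subset)
  show "ord_inj n \<subseteq> PiE UNIV (\<lambda>_. {1..n})"
    by (auto simp: ord_inj_def)
qed (simp add: finite_PiE)

lemma finite_bar_forms: "finite (bar_forms n)"
proof (rule finite_subset)
  show "bar_forms n \<subseteq> PiE UNIV (\<lambda>_. UNIV <+> {1..n})"
    by (auto simp: bar_forms_def)
qed (simp add: finite_PiE)

lemma finite_tensor_indices:
  assumes "finite B"
  shows "finite (tensor_indices B m :: ('d::finite, 'f) tensor_index set)"
proof -
  have "{\<pi> :: 'd \<Rightarrow> nat \<Rightarrow> nat. \<forall>j. \<pi> j permutes {1..m}} = PiE UNIV (\<lambda>_. {\<sigma>. \<sigma> permutes {1..m}})"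
    by auto
  then show ?thesis
    using assms by (simp add: tensor_indices_def finite_PiE finite_permutations)
qed

lemma has_partial_deriv_iff:
  fixes f :: "real^'d::finite \<Rightarrow> real"
  shows "((\<lambda>h. f (s + h *\<^sub>R axis j 1)) has_vector_derivative D)
           (at 0 within {h. s + h *\<^sub>R axis j 1 \<in> cbox 0 1}) \<longleftrightarrow>
         (\<forall>\<epsilon>>0. \<exists>\<delta>>0. \<forall>h. s + h *\<^sub>R axis j 1 \<in> cbox 0 1 \<longrightarrow> \<bar>h\<bar> < \<delta> \<longrightarrow>
            \<bar>f (s + h *\<^sub>R axis j 1) - f s - h * D\<bar> \<le> \<epsilon> * \<bar>h\<bar>)"
  unfolding has_vector_derivative_def has_derivative_within_alt
  by (simp add: bounded_linear_mult_left)

definition cube_step :: "'d::finite \<Rightarrow> nat \<Rightarrow> real^'d \<Rightarrow> real" where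
  "cube_step j n s = (if s $ j \<le> 1/2 then 1 else -1) / (real n + 2)"

lemma step_in:
  fixes s :: "real^'d::finite"
  assumes "s \<in> cbox 0 1"
  shows "s + cube_step j n s *\<^sub>R axis j 1 \<in> cbox 0 1"
proof -
  have "1 / (real n + 2) \<le> 1 / 2" "0 \<le> 1 / (real n + 2)"
    by (auto simp: field_simps)
  moreover have "cube_step j n s = (if s $ j \<le> 1/2 then 1 / (real n + 2) else - (1 / (real n + 2)))"
    by (simp add: cube_step_def)
  ultimately show ?thesis
    using cube_nth[OF assms, of j] unfolding cube_line[OF assms] by (smt (verit) field_sum_of_halves)
qed

lemma abs_step: "\<bar>cube_step j n s\<bar> = 1 / (real n + 2)"
  by (auto simp: cube_step_def)

lemma step_small:
  fixes s :: "real^'d::finite"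
  assumes "\<delta> > 0"
  shows "\<forall>\<^sub>F n in sequentially. \<bar>cube_step j n s\<bar> < \<delta>"
proof -
  have "(\<lambda>n. 1 / (real n + 2)) \<longlonglongrightarrow> 0"
    by real_asymp
  then show ?thesis
    unfolding abs_step using assms by (rule order_tendstoD)
qed

lemma step_lim:
  fixes f :: "real^'d::finite \<Rightarrow> real"
  assumes "s \<in> cbox 0 1"
    and "((\<lambda>h. f (s + h *\<^sub>R axis j 1)) has_vector_derivative D)
           (at 0 within {h. s + h *\<^sub>R axis j 1 \<in> cbox 0 1})"
  shows "(\<lambda>n. (f (s + cube_step j n s *\<^sub>R axis j 1) - f s) / cube_step j n s) \<longlonglongrightarrow> D"
proof (rule tendstoI)
  fix \<epsilon> :: real assume "\<epsilon> > 0"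
  then have "\<epsilon> / 2 > 0" by simp
  then obtain \<delta> where "\<delta> > 0" and \<delta>: "\<And>h. s + h *\<^sub>R axis j 1 \<in> cbox 0 1 \<Longrightarrow> \<bar>h\<bar> < \<delta> \<Longrightarrow>
            \<bar>f (s + h *\<^sub>R axis j 1) - f s - h * D\<bar> \<le> \<epsilon> / 2 * \<bar>h\<bar>"
    using assms(2) unfolding has_partial_deriv_iff by meson
  from step_small[OF \<open>\<delta> > 0\<close>, of j s]
  show "\<forall>\<^sub>F n in sequentially. dist ((f (s + cube_step j n s *\<^sub>R axis j 1) - f s) / cube_step j n s) D < \<epsilon>"
  proof eventually_elim
    case (elim n)
    let ?h = "cube_step j n s"
    have h: "\<bar>?h\<bar> > 0" by (simp add: abs_step)
    have "\<bar>(f (s + ?h *\<^sub>R axis j 1) - f s) / ?h - D\<bar> = \<bar>f (s + ?h *\<^sub>R axis j 1) - f s - ?h * D\<bar> / \<bar>?h\<bar>"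
      using h by (simp add: field_simps flip: abs_divide)
    also have "\<dots> \<le> \<epsilon> / 2"
      using \<delta>[OF step_in[OF assms(1)] elim] h by (simp add: divide_simps)
    finally show ?case using \<open>\<epsilon> > 0\<close> by (simp add: dist_real_def)
  qed
qed

lemma has_partial_deriv_iff_rat:
  fixes f :: "real^'d::finite \<Rightarrow> real"
  assumes "s \<in> cbox 0 1" "continuous_on (cbox 0 1) f"
  shows "((\<lambda>h. f (s + h *\<^sub>R axis j 1)) has_vector_derivative D)
           (at 0 within {h. s + h *\<^sub>R axis j 1 \<in> cbox 0 1}) \<longleftrightarrow>
         (\<forall>k. \<exists>l. \<forall>q. s + of_rat q *\<^sub>R axis j 1 \<in> cbox 0 1 \<longrightarrow> \<bar>of_rat q\<bar> < 1 / (real l + 1) \<longrightarrow>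
            \<bar>f (s + of_rat q *\<^sub>R axis j 1) - f s - of_rat q * D\<bar> \<le> \<bar>of_rat q\<bar> / (real k + 1))"
  (is "?L \<longleftrightarrow> ?R")
proof
  assume L: ?L
  show ?R
  proof
    fix k :: nat
    have "1 / (real k + 1) > 0" by simp
    then obtain \<delta> where "\<delta> > 0" and \<delta>: "\<And>h. s + h *\<^sub>R axis j 1 \<in> cbox 0 1 \<Longrightarrow> \<bar>h\<bar> < \<delta> \<Longrightarrow>
              \<bar>f (s + h *\<^sub>R axis j 1) - f s - h * D\<bar> \<le> 1 / (real k + 1) * \<bar>h\<bar>"
      using L unfolding has_partial_deriv_iff by meson
    obtain l where "1 / (real l + 1) < \<delta>"
      using reals_Archimedean[OF \<open>\<delta> > 0\<close>] by (auto simp: inverse_eq_divide add.commute)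
    then show "\<exists>l. \<forall>q. s + of_rat q *\<^sub>R axis j 1 \<in> cbox 0 1 \<longrightarrow> \<bar>of_rat q\<bar> < 1 / (real l + 1) \<longrightarrow>
            \<bar>f (s + of_rat q *\<^sub>R axis j 1) - f s - of_rat q * D\<bar> \<le> \<bar>of_rat q\<bar> / (real k + 1)"
      using \<delta> by (intro exI[of _ l]) fastforce
  qed
next
  assume R: ?R
  show ?L
    unfolding has_partial_deriv_iff
  proof (intro allI impI)
    fix \<epsilon> :: real assume "\<epsilon> > 0"
    then obtain k where k: "1 / (real k + 1) < \<epsilon>"
      using reals_Archimedean by (auto simp: inverse_eq_divide add.commute)
    obtain l where l: "\<And>q. s + of_rat q *\<^sub>R axis j 1 \<in> cbox 0 1 \<Longrightarrow> \<bar>of_rat q\<bar> < 1 / (real l + 1) \<Longrightarrow>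
            \<bar>f (s + of_rat q *\<^sub>R axis j 1) - f s - of_rat q * D\<bar> \<le> \<bar>of_rat q\<bar> / (real k + 1)"
      using R by metis
    define I where "I = {- (s $ j)..1 - s $ j} \<inter> {- (1 / (real l + 1))<..<1 / (real l + 1)}"
    have Icube: "s + h *\<^sub>R axis j 1 \<in> cbox 0 1" if "h \<in> closure I" for h
    proof -
      have "closure I \<subseteq> {- (s $ j)..1 - s $ j}"
        by (rule closure_minimal) (auto simp: I_def)
      then show ?thesis
        using that by (auto simp: cube_line[OF assms(1)])
    qed
    have conv: "convex I" by (auto simp: I_def intro: convex_Int)
    have int: "interior I \<noteq> {}"
    proof -
      define m where "m = 1 / (real l + 1)"
      have "m > 0" by (simp add: m_def)
      have "{max (- (s $ j)) (-m)<..<min (1 - s $ j) m} \<subseteq> I"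
        by (auto simp: I_def m_def)
      then have "{max (- (s $ j)) (-m)<..<min (1 - s $ j) m} \<subseteq> interior I"
        by (intro interior_maximal) auto
      moreover have "max (- (s $ j)) (-m) < min (1 - s $ j) m"
        using cube_nth[OF assms(1), of j] \<open>m > 0\<close> by (auto simp: max_def min_def)
      ultimately show ?thesis
        using dense by fastforce
    qed
    have closure: "closure (I \<inter> \<rat>) = closure I"
    proof
      show "closure (I \<inter> \<rat>) \<subseteq> closure I" by (intro closure_mono) auto
      have "interior I \<subseteq> closure (interior I \<inter> \<rat>)"
        using open_Int_closure_subset[OF open_interior, of I "\<rat>"] by (simp add: Rats_closure_real)
      then have "closure (interior I) \<subseteq> closure (interior I \<inter> \<rat>)"
        by (intro closure_minimal) auto
      also have "\<dots> \<subseteq> closure (I \<inter> \<rat>)"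
        using interior_subset by (intro closure_mono) auto
      finally show "closure I \<subseteq> closure (I \<inter> \<rat>)"
        using convex_closure_interior[OF conv int] by simp
    qed
    define g where "g h = \<bar>f (s + h *\<^sub>R axis j 1) - f s - h * D\<bar> - \<bar>h\<bar> / (real k + 1)" for h
    have "continuous_on (closure (I \<inter> \<rat>)) g"
      unfolding g_def closure
      by (intro continuous_intros continuous_on_compose2[OF assms(2)]) (use Icube in auto)
    moreover have "g h \<le> 0" if h: "h \<in> I \<inter> \<rat>" for h
    proof -
      obtain q where q: "h = of_rat q" using h by (auto simp: Rats_def)
      have "s + h *\<^sub>R axis j 1 \<in> cbox 0 1" using h closure_subset Icube by blast
      then show ?thesis
        using l[of q] h unfolding g_def q I_def by (smt (verit) Int_iff greaterThanLessThan_iff)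
    qed
    ultimately have g: "g h \<le> 0" if "h \<in> closure I" for h
      using continuous_le_on_closure[of "I \<inter> \<rat>" g h 0] that closure by auto
    show "\<exists>\<delta>>0. \<forall>h. s + h *\<^sub>R axis j 1 \<in> cbox 0 1 \<longrightarrow> \<bar>h\<bar> < \<delta> \<longrightarrow>
            \<bar>f (s + h *\<^sub>R axis j 1) - f s - h * D\<bar> \<le> \<epsilon> * \<bar>h\<bar>"
    proof (intro exI[of _ "1 / (real l + 1)"] conjI allI impI)
      fix h assume h: "s + h *\<^sub>R axis j 1 \<in> cbox 0 1" "\<bar>h\<bar> < 1 / (real l + 1)"
      then have "h \<in> I" by (auto simp: I_def cube_line[OF assms(1)])
      then have "g h \<le> 0" using g closure_subset by blast
      moreover have "1 / (real k + 1) * \<bar>h\<bar> \<le> \<epsilon> * \<bar>h\<bar>"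
        using k by (intro mult_right_mono) auto
      ultimately show "\<bar>f (s + h *\<^sub>R axis j 1) - f s - h * D\<bar> \<le> \<epsilon> * \<bar>h\<bar>"
        by (simp add: g_def)
    qed simp
  qed
qed

lemma borel_measurable_partial_deriv:
  fixes f :: "real^'d::finite \<Rightarrow> real"
  assumes f: "continuous_on (cbox 0 1) f"
  shows "partial_deriv f j \<in> borel_measurable (restrict_space borel (cbox 0 1))"
proof -
  define F where "F z = (if z \<in> cbox 0 1 then f z else 0)" for z
  have F [measurable]: "F \<in> borel_measurable borel"
    unfolding F_def by (intro borel_measurable_continuous_on_if f) auto
  have cube_step [measurable]: "cube_step j n \<in> borel_measurable borel" for n
    unfolding cube_step_def by measurable
  define D where "D s = lim (\<lambda>n. (F (s + cube_step j n s *\<^sub>R axis j 1) - F s) / cube_step j n s)" for s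
  have D [measurable]: "D \<in> borel_measurable borel"
    unfolding D_def by measurable
  define E where "E s \<longleftrightarrow> (\<forall>k. \<exists>l. \<forall>q. s + of_rat q *\<^sub>R axis j 1 \<in> cbox 0 1 \<longrightarrow>
      \<bar>of_rat q\<bar> < 1 / (real (l::nat) + 1) \<longrightarrow>
      \<bar>F (s + of_rat q *\<^sub>R axis j 1) - F s - of_rat q * D s\<bar> \<le> \<bar>of_rat q\<bar> / (real (k::nat) + 1))" for s
  have [measurable]: "Measurable.pred borel E"
    unfolding E_def by measurable
  have eq: "partial_deriv f j s = (if E s then D s else (SOME D. False))" if s: "s \<in> cbox 0 1" for s
  proof -
    let ?has = "\<lambda>D. ((\<lambda>h. f (s + h *\<^sub>R axis j 1)) has_vector_derivative D)
           (at 0 within {h. s + h *\<^sub>R axis j 1 \<in> cbox 0 1})"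
    have Ds: "D s = D'" if "?has D'" for D'
      using step_lim[OF s that] step_in[OF s] s by (simp add: D_def F_def limI)
    have E: "E s \<longleftrightarrow> ?has (D s)"
      unfolding has_partial_deriv_iff_rat[OF s f] E_def using s by (simp add: F_def cong: imp_cong)
    show ?thesis
    proof (cases "E s")
      case True
      then show ?thesis using E partial_deriv_eqI[OF s] by simp
    next
      case False
      then have "?has = (\<lambda>_. False)" using E Ds by blast
      then show ?thesis using False by (simp add: partial_deriv_def vector_derivative_def)
    qed
  qed
  have "(\<lambda>s. if E s then D s else (SOME D. False)) \<in> borel_measurable (restrict_space borel (cbox 0 1))"
    by (intro measurable_restrict_space1) measurable
  then show ?thesis
    by (subst measurable_cong[where g = "\<lambda>s. if E s then D s else (SOME D. False)"])
      (auto simp: space_restrict_space eq)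
qed

lemma partial_deriv_bounded:
  fixes f :: "real^'d::finite \<Rightarrow> real"
  assumes f: "C-lipschitz_on (cbox 0 1) f"
  shows "\<exists>K. \<forall>s\<in>cbox 0 1. \<bar>partial_deriv f j s\<bar> \<le> K"
proof (intro exI ballI)
  fix s :: "real^'d" assume s: "s \<in> cbox 0 1"
  let ?has = "\<lambda>D. ((\<lambda>h. f (s + h *\<^sub>R axis j 1)) has_vector_derivative D)
         (at 0 within {h. s + h *\<^sub>R axis j 1 \<in> cbox 0 1})"
  show "\<bar>partial_deriv f j s\<bar> \<le> max C \<bar>SOME D. False\<bar>"
  proof (cases "\<exists>D. ?has D")
    case True
    then obtain D where D: "?has D" by blast
    have "\<bar>(f (s + cube_step j n s *\<^sub>R axis j 1) - f s) / cube_step j n s\<bar> \<le> C" for n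
    proof -
      have "\<bar>f (s + cube_step j n s *\<^sub>R axis j 1) - f s\<bar> \<le> C * \<bar>cube_step j n s\<bar>"
        using lipschitz_onD[OF f step_in[OF s, of j n] s] by (simp add: dist_norm)
      moreover have "\<bar>cube_step j n s\<bar> > 0" by (simp add: abs_step)
      ultimately show ?thesis by (simp add: divide_simps)
    qed
    then have "\<bar>D\<bar> \<le> C"
      by (intro LIMSEQ_le_const2[OF tendsto_rabs[OF step_lim[OF s D]]]) auto
    then show ?thesis using partial_deriv_eqI[OF s D] by simp
  next
    case False
    then have "?has = (\<lambda>_. False)" by blast
    then show ?thesis by (simp add: partial_deriv_def vector_derivative_def)
  qed
qed

lemma lipschitz_on_inner:
  fixes x :: "_ \<Rightarrow> 'e::real_inner"
  assumes "C-lipschitz_on S x"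
  shows "(C * norm b)-lipschitz_on S (\<lambda>s. x s \<bullet> b)"
proof (rule lipschitz_onI)
  fix s t assume "s \<in> S" "t \<in> S"
  then have "norm (x s - x t) \<le> C * dist s t"
    using lipschitz_onD[OF assms] by (simp add: dist_norm)
  moreover have "\<bar>(x s - x t) \<bullet> b\<bar> \<le> norm (x s - x t) * norm b"
    by (rule Cauchy_Schwarz_ineq2)
  ultimately have "\<bar>(x s - x t) \<bullet> b\<bar> \<le> (C * dist s t) * norm b"
    by (meson mult_right_mono norm_ge_zero order_trans)
  then show "dist (x s \<bullet> b) (x t \<bullet> b) \<le> C * norm b * dist s t"
    by (simp add: dist_real_def inner_diff_left algebra_simps)
qed (use lipschitz_on_nonneg[OF assms] in auto)

lemma LipE:
  assumes "x \<in> Lip"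
  obtains C where "C-lipschitz_on (cbox 0 1) (\<lambda>s. x s \<bullet> b)"
  using assms lipschitz_on_inner unfolding Lip_def by blast

lemma borel_measurable_jac_minor:
  assumes "x \<in> Lip"
  shows "jac_minor b x Q \<in> borel_measurable (restrict_space borel (cbox 0 1))"
proof -
  have [measurable]: "partial_deriv (\<lambda>s. x s \<bullet> b (Q i)) j \<in> borel_measurable (restrict_space borel (cbox 0 1))" for i j
    by (rule LipE[OF assms, of "b (Q i)"]) (blast intro: borel_measurable_partial_deriv lipschitz_on_continuous_on)
  show ?thesis
    unfolding jac_minor_def[abs_def] det_def by simp
qed

lemma jac_minor_bounded:
  fixes x :: "real^'d::finite \<Rightarrow> 'e::real_inner"
  assumes "x \<in> Lip"
  shows "\<exists>K. \<forall>s\<in>cbox 0 1. \<bar>jac_minor b x Q s\<bar> \<le> K"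
proof -
  have "\<forall>i j. \<exists>K. \<forall>s\<in>cbox 0 1. \<bar>partial_deriv (\<lambda>s. x s \<bullet> b (Q i)) j s\<bar> \<le> K"
    using LipE[OF assms] partial_deriv_bounded by metis
  then obtain K where K: "\<And>i j s. s \<in> cbox 0 1 \<Longrightarrow> \<bar>partial_deriv (\<lambda>s. x s \<bullet> b (Q i)) j s\<bar> \<le> K i j"
    by metis
  have "\<bar>jac_minor b x Q s\<bar> \<le> (\<Sum>p | p permutes (UNIV :: 'd set). \<Prod>i\<in>UNIV. K i (p i))"
    if "s \<in> cbox 0 1" for s
    unfolding jac_minor_def det_def
    by (rule order_trans[OF sum_abs])
      (auto intro!: sum_mono prod_mono K[OF that] simp: abs_mult abs_prod sign_def)
  then show ?thesis by blast
qed

lemma esssup_real: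
  fixes g :: "'a \<Rightarrow> real"
  assumes [measurable]: "g \<in> borel_measurable M" and M: "emeasure M (space M) \<noteq> 0"
    and "AE s in M. 0 \<le> g s" and "AE s in M. g s \<le> K"
  shows "0 \<le> real_of_ereal (esssup M (\<lambda>s. ereal (g s)))"
    and "AE s in M. g s \<le> real_of_ereal (esssup M (\<lambda>s. ereal (g s)))"
    and "\<And>c. AE s in M. g s \<le> c \<Longrightarrow> real_of_ereal (esssup M (\<lambda>s. ereal (g s))) \<le> c"
proof -
  let ?e = "esssup M (\<lambda>s. ereal (g s))"
  have "(\<lambda>s. ereal (g s)) \<in> borel_measurable M" by measurable
  then have le: "?e \<le> ereal c" if "AE s in M. g s \<le> c" for c
    using that by (intro esssup_I) auto
  have "esssup M (\<lambda>_. 0 :: ereal) \<le> ?e"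
    using assms(3) by (intro esssup_AE_mono) auto
  then have "0 \<le> ?e" using esssup_const[OF M, of "0 :: ereal"] by simp
  moreover have "?e \<le> ereal K" by (rule le[OF assms(4)])
  ultimately obtain r where r: "?e = ereal r" "0 \<le> r"
    by (cases ?e) auto
  show "0 \<le> real_of_ereal ?e" using r by simp
  show "AE s in M. g s \<le> real_of_ereal ?e"
    using esssup_AE[of "\<lambda>s. ereal (g s)" M] r by simp
  show "real_of_ereal ?e \<le> c" if "AE s in M. g s \<le> c" for c
    using le[OF that] r by simp
qed

lemma cube_nonnull: "emeasure (lebesgue_on (cbox 0 (1 :: real^'d::finite))) (space (lebesgue_on (cbox 0 1))) \<noteq> 0"
proof -
  have "(0 :: real^'d) \<bullet> b \<le> 1 \<bullet> b" if "b \<in> Basis" for b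
    using that by (auto simp: Basis_vec_def inner_axis)
  then have "emeasure lborel (cbox 0 (1 :: real^'d)) = (\<Prod>b\<in>Basis. ennreal ((1 - 0 :: real^'d) \<bullet> b))"
    by (simp add: emeasure_lborel_cbox prod_ennreal)
  also have "\<dots> \<noteq> 0"
    by (auto simp: Basis_vec_def inner_axis)
  finally show ?thesis
    by (simp add: emeasure_restrict_space)
qed

lemma borel_measurable_dhat:
  assumes "x \<in> Lip"
  shows "(\<lambda>s. dhat e x s P) \<in> borel_measurable (lebesgue_on (cbox 0 1))"
proof -
  have "dhat e x s P = jac_minor e x P s" for s by (simp add: dhat_def)
  moreover have "jac_minor e x P \<in> borel_measurable (lebesgue_on (cbox 0 1))"
    using borel_measurable_jac_minor[OF assms, of e P]
    by (simp add: borel_measurable_restrict_space_iff borel_measurable_if measurable_completion)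
  ultimately show ?thesis by simp
qed

lemma Linf_norm_diff:
  fixes x y :: "(real, 'd::{finite,linorder}) vec \<Rightarrow> 'v::real_inner" and e :: "nat \<Rightarrow> 'v" and n :: nat
  assumes x: "x \<in> Lip" and y: "y \<in> Lip" and "\<bar>a\<bar> \<le> 1"
  defines "N \<equiv> Linf_norm n (\<lambda>s P. dhat e x s P - a * dhat e y s P)"
  shows "0 \<le> N"
    and "AE s in lebesgue_on (cbox 0 1). L2_set (\<lambda>P. dhat e x s P - a * dhat e y s P) (ord_inj n) \<le> N"
    and "\<And>c. AE s in lebesgue_on (cbox 0 1).
           L2_set (\<lambda>P. dhat e x s P - a * dhat e y s P) (ord_inj n) \<le> c \<Longrightarrow> N \<le> c"
proof -
  let ?g = "\<lambda>s. L2_set (\<lambda>P. dhat e x s P - a * dhat e y s P) (ord_inj n)"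
  note [measurable] = borel_measurable_dhat[OF x] borel_measurable_dhat[OF y]
  have meas: "?g \<in> borel_measurable (lebesgue_on (cbox 0 1))"
    unfolding L2_set_def by measurable
  obtain K where K: "\<And>P s. s \<in> cbox 0 1 \<Longrightarrow> \<bar>dhat e x s P\<bar> \<le> K P"
    using jac_minor_bounded[OF x, of e] unfolding dhat_def by metis
  obtain K' where K': "\<And>P s. s \<in> cbox 0 1 \<Longrightarrow> \<bar>dhat e y s P\<bar> \<le> K' P"
    using jac_minor_bounded[OF y, of e] unfolding dhat_def by metis
  have "\<bar>dhat e x s P - a * dhat e y s P\<bar> \<le> K P + K' P" if "s \<in> cbox 0 1" for s P
  proof -
    have "\<bar>a * dhat e y s P\<bar> \<le> 1 * K' P"
      unfolding abs_mult using K'[OF that, of P] assms(3) by (intro mult_mono) auto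
    then show ?thesis using K[OF that, of P] by linarith
  qed
  then have "?g s \<le> (\<Sum>P\<in>ord_inj n. K P + K' P)" if "s \<in> cbox 0 1" for s
    using that by (intro order_trans[OF L2_set_le_sum_abs] sum_mono) auto
  then have bdd: "AE s in lebesgue_on (cbox 0 1). ?g s \<le> (\<Sum>P\<in>ord_inj n. K P + K' P)"
    by (intro AE_I2) auto
  have "AE s in lebesgue_on (cbox 0 1). 0 \<le> ?g s" by simp
  note E = esssup_real[OF meas cube_nonnull this bdd]
  show "0 \<le> N" "AE s in lebesgue_on (cbox 0 1). ?g s \<le> N"
    "\<And>c. AE s in lebesgue_on (cbox 0 1). ?g s \<le> c \<Longrightarrow> N \<le> c"
    unfolding N_def Linf_norm_def by (fact E)+
qed

abbreviation mu_rep ::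
  "(nat \<Rightarrow> 'v::real_inner) \<Rightarrow> nat \<Rightarrow> (real^'d::{finite,linorder} \<Rightarrow> 'v) \<Rightarrow> ((real,'d) vec \<Rightarrow> 'v) \<Rightarrow> real" where
  "mu_rep e n x y \<equiv> Linf_norm n (\<lambda>s P. dhat e x s P - dhat e y s P)"

lemmas mu_rep = Linf_norm_diff[where a = 1, simplified]
lemmas norm_rep = Linf_norm_diff[where a = 0, simplified]

lemma L2_set_diff_commute: "L2_set (\<lambda>i. f i - g i) A = L2_set (\<lambda>i. g i - f i) A" for f g :: "_ \<Rightarrow> real"
  by (simp add: L2_set_def power2_commute)

lemma L2_set_diff_triangle:
  "L2_set (\<lambda>i. f i - h i) A \<le> L2_set (\<lambda>i. f i - g i) A + L2_set (\<lambda>i. g i - h i) A"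
  for f g h :: "_ \<Rightarrow> real"
  using L2_set_triangle_ineq[of "\<lambda>i. f i - g i" "\<lambda>i. g i - h i" A] by simp

lemma mu_rep_commute: "mu_rep e n x y = mu_rep e n y x"
  unfolding Linf_norm_def by (subst L2_set_diff_commute) (rule refl)

lemma mu_rep_triangle:
  assumes "x \<in> Lip" "y \<in> Lip" "z \<in> Lip"
  shows "mu_rep e n x z \<le> mu_rep e n x y + mu_rep e n y z"
proof (rule mu_rep(3)[OF assms(1,3)])
  show "AE s in lebesgue_on (cbox 0 1).
      L2_set (\<lambda>P. dhat e x s P - dhat e z s P) (ord_inj n) \<le> mu_rep e n x y + mu_rep e n y z"
    using mu_rep(2)[OF assms(1,2), where e = e and n = n] mu_rep(2)[OF assms(2,3), where e = e and n = n]
    by eventually_elim (rule order_trans[OF L2_set_diff_triangle add_mono])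
qed

lemma mu_rep_eq_0:
  assumes "x \<in> Lip" "y \<in> Lip"
  shows "mu_rep e n x y = 0 \<longleftrightarrow> (x, y) \<in> jac_equiv e n"
proof
  assume "mu_rep e n x y = 0"
  then have "AE s in lebesgue_on (cbox 0 1). L2_set (\<lambda>P. dhat e x s P - dhat e y s P) (ord_inj n) = 0"
    using mu_rep(2)[OF assms, where e = e and n = n] by (simp add: antisym_conv)
  then show "(x, y) \<in> jac_equiv e n"
    using assms by (simp add: jac_equiv_def L2_set_eq_0_iff finite_ord_inj)
next
  assume "(x, y) \<in> jac_equiv e n"
  then have "AE s in lebesgue_on (cbox 0 1). \<forall>P\<in>ord_inj n. dhat e x s P = dhat e y s P"
    by (simp add: jac_equiv_def)
  then have "AE s in lebesgue_on (cbox 0 1). L2_set (\<lambda>P. dhat e x s P - dhat e y s P) (ord_inj n) \<le> 0"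
    by eventually_elim (simp add: L2_set_0')
  then show "mu_rep e n x y = 0"
    using mu_rep(1,3)[OF assms, where e = e and n = n] by (meson antisym)
qed

lemma equiv_jac_equiv: "equiv Lip (jac_equiv e n)"
proof (rule equivI)
  show "jac_equiv e n \<subseteq> Lip \<times> Lip" by (auto simp: jac_equiv_def)
  show "refl_on Lip (jac_equiv e n)" by (auto simp: refl_on_def jac_equiv_def)
  show "sym (jac_equiv e n)"
    by (auto simp: sym_def jac_equiv_def elim!: eventually_mono)
  show "trans (jac_equiv e n)"
  proof (rule transI)
    fix x y z assume "(x, y) \<in> jac_equiv e n" "(y, z) \<in> jac_equiv e n"
    then show "(x, z) \<in> jac_equiv e n"
      unfolding jac_equiv_def by (auto elim: eventually_elim2)
  qed
qed

lemma LipJ_nonempty: "X \<in> LipJ e n \<Longrightarrow> \<exists>x\<in>Lip. x \<in> X"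
  using equiv_jac_equiv in_quotient_imp_non_empty in_quotient_imp_subset unfolding LipJ_def by blast

lemma LipJ_Lip: "X \<in> LipJ e n \<Longrightarrow> x \<in> X \<Longrightarrow> x \<in> Lip"
  using equiv_jac_equiv in_quotient_imp_subset unfolding LipJ_def by blast

lemma LipJ_equiv: "X \<in> LipJ e n \<Longrightarrow> x \<in> X \<Longrightarrow> y \<in> X \<Longrightarrow> (x, y) \<in> jac_equiv e n"
  using equiv_jac_equiv in_quotient_imp_in_rel unfolding LipJ_def by fastforce

lemma the_elem_image_eq: "x \<in> X \<Longrightarrow> (\<And>y. y \<in> X \<Longrightarrow> f y = f x) \<Longrightarrow> the_elem (f ` X) = f x"
  by (metis (no_types, lifting) empty_iff the_elem_image_unique)

lemma dhat_norm_eq: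
  assumes "X \<in> LipJ e n" "x \<in> X"
  shows "dhat_norm e n X = Linf_norm n (dhat e x)"
proof -
  have le: "Linf_norm n (dhat e y) \<le> Linf_norm n (dhat e x)" if "x \<in> X" "y \<in> X" for x y
  proof (rule norm_rep(3))
    show "y \<in> Lip" "y \<in> Lip" using LipJ_Lip assms(1) that by blast+
    have "AE s in lebesgue_on (cbox 0 1). \<forall>P\<in>ord_inj n. dhat e y s P = dhat e x s P"
      using LipJ_equiv[OF assms(1) that(2,1)] by (simp add: jac_equiv_def)
    moreover have "x \<in> Lip" using LipJ_Lip assms(1) that by blast
    then have "AE s in lebesgue_on (cbox 0 1). L2_set (dhat e x s) (ord_inj n) \<le> Linf_norm n (dhat e x)"
      using norm_rep(2)[of x x, where e = e and n = n] by simp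
    ultimately show "AE s in lebesgue_on (cbox 0 1). L2_set (dhat e y s) (ord_inj n) \<le> Linf_norm n (dhat e x)"
      by eventually_elim (simp cong: L2_set_cong)
  qed
  show ?thesis
    unfolding dhat_norm_def
    by (rule the_elem_image_eq[OF assms(2)]) (use le assms(2) in \<open>auto intro: antisym\<close>)
qed

lemma mu_inf_eq:
  assumes "X \<in> LipJ e n" "Y \<in> LipJ e n" "x \<in> X" "y \<in> Y"
  shows "mu_inf e n X Y = mu_rep e n x y"
proof -
  have le: "mu_rep e n x' y' \<le> mu_rep e n x y" if "x \<in> X" "y \<in> Y" "x' \<in> X" "y' \<in> Y" for x y x' y'
  proof -
    have L: "x \<in> Lip" "y \<in> Lip" "x' \<in> Lip" "y' \<in> Lip" using LipJ_Lip assms that by blast+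
    have "mu_rep e n x' x = 0" "mu_rep e n y y' = 0"
      using mu_rep_eq_0 L LipJ_equiv assms that by blast+
    then show ?thesis
      using mu_rep_triangle[OF L(3,1,4), where e = e and n = n] mu_rep_triangle[OF L(1,2,4), where e = e and n = n] by linarith
  qed
  have "mu_inf e n X Y = (\<lambda>(x, y). mu_rep e n x y) (x, y)"
    unfolding mu_inf_def if_P[OF conjI[OF assms(1,2)]]
    by (rule the_elem_image_eq) (use le assms in \<open>auto intro: antisym\<close>)
  then show ?thesis by simp
qed

lemma mu_inf_nonneg: "0 \<le> mu_inf e n X Y"
proof (cases "X \<in> LipJ e n \<and> Y \<in> LipJ e n")
  case True
  then obtain x y where "x \<in> Lip" "x \<in> X" "y \<in> Lip" "y \<in> Y"
    using LipJ_nonempty by blast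
  with True show ?thesis
    using mu_inf_eq[of X e n Y x y] mu_rep(1)[of x y, where e = e and n = n] by simp
qed (auto simp: mu_inf_def)

lemma mu_inf_commute: "mu_inf e n X Y = mu_inf e n Y X"
proof (cases "X \<in> LipJ e n \<and> Y \<in> LipJ e n")
  case True
  then obtain x y where "x \<in> X" "y \<in> Y"
    using LipJ_nonempty by blast
  with True show ?thesis
    using mu_inf_eq[of X e n Y x y] mu_inf_eq[of Y e n X y x] mu_rep_commute[of n e x y] by simp
qed (auto simp: mu_inf_def)

theorem Metric_space_LipJ:
  fixes e :: "nat \<Rightarrow> 'v::real_inner"
  shows "Metric_space (LipJ e n :: (real^'d::{finite,linorder} \<Rightarrow> 'v) set set) (mu_inf e n)"
proof
  fix X Y Z :: "((real,'d) vec \<Rightarrow> 'v) set"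
  show "0 \<le> mu_inf e n X Y" by (rule mu_inf_nonneg)
  show "mu_inf e n X Y = mu_inf e n Y X" by (rule mu_inf_commute)
  assume X: "X \<in> LipJ e n" and Y: "Y \<in> LipJ e n"
  obtain x y where xy: "x \<in> Lip" "x \<in> X" "y \<in> Lip" "y \<in> Y"
    using LipJ_nonempty[OF X] LipJ_nonempty[OF Y] by blast
  have "mu_inf e n X Y = 0 \<longleftrightarrow> (x, y) \<in> jac_equiv e n"
    unfolding mu_inf_eq[OF X Y xy(2,4)] by (rule mu_rep_eq_0[OF xy(1,3)])
  also have "\<dots> \<longleftrightarrow> X = Y"
    using quotient_eq_iff[OF equiv_jac_equiv X[unfolded LipJ_def] Y[unfolded LipJ_def] xy(2,4)] by blast
  finally show "mu_inf e n X Y = 0 \<longleftrightarrow> X = Y" .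
  assume Z: "Z \<in> LipJ e n"
  obtain z where z: "z \<in> Lip" "z \<in> Z"
    using LipJ_nonempty[OF Z] by blast
  show "mu_inf e n X Z \<le> mu_inf e n X Y + mu_inf e n Y Z"
    unfolding mu_inf_eq[OF X Y xy(2,4)] mu_inf_eq[OF X Z xy(2) z(2)] mu_inf_eq[OF Y Z xy(4) z(2)]
    by (rule mu_rep_triangle[OF xy(1,3) z(1)])
qed

lemma hilb_dist_nonneg: "0 \<le> hilb_dist B r r'"
  by (simp add: hilb_dist_def infsum_nonneg)

lemma hilb_dist_commute: "hilb_dist B r r' = hilb_dist B r' r"
  unfolding hilb_dist_def L2_set_diff_commute[of "r _"] ..

lemma hilb_dist_le:
  assumes "\<And>N. L2_set (\<lambda>m. L2_set (\<lambda>a. r m a - r' m a) (tensor_indices B m)) {..<N} \<le> c"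
  shows "(\<lambda>m. (L2_set (\<lambda>a. r m a - r' m a) (tensor_indices B m))\<^sup>2) summable_on UNIV"
    and "hilb_dist B r r' \<le> c"
proof -
  let ?D = "\<lambda>m. (L2_set (\<lambda>a. r m a - r' m a) (tensor_indices B m))\<^sup>2"
  have bd: "(\<Sum>m<N. ?D m) \<le> c\<^sup>2" for N
    using assms[of N] unfolding L2_set_def[of _ "{..<N}"] by (rule sqrt_le_D)
  have "summable ?D"
    using bd[of "Suc _"] by (intro bounded_imp_summable[where B = "c\<^sup>2"]) (simp_all add: lessThan_Suc_atMost)
  then show S: "?D summable_on UNIV"
    by (simp add: summable_on_UNIV_nonneg_real_iff)
  have "infsum ?D UNIV = suminf ?D"
    by (rule sums_unique[OF has_sum_imp_sums[OF has_sum_infsum[OF S]]])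
  also have "\<dots> \<le> c\<^sup>2"
    using bd \<open>summable ?D\<close> by (intro suminf_le_const) auto
  finally show "hilb_dist B r r' \<le> c"
    using assms[of 0] by (simp add: hilb_dist_def real_le_lsqrt)
qed

lemma hilb_dist_ge:
  assumes "(\<lambda>m. (L2_set (\<lambda>a. r m a - r' m a) (tensor_indices B m))\<^sup>2) summable_on UNIV"
  shows "L2_set (\<lambda>m. L2_set (\<lambda>a. r m a - r' m a) (tensor_indices B m)) {..<N} \<le> hilb_dist B r r'"
  unfolding hilb_dist_def L2_set_def[of _ "{..<N}"]
  by (intro real_sqrt_le_mono finite_sum_le_infsum assms) auto

lemma hilb_dist_triangle':
  assumes "(\<lambda>m. (L2_set (\<lambda>a. r m a - r' m a) (tensor_indices B m))\<^sup>2) summable_on UNIV"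
    and "(\<lambda>m. (L2_set (\<lambda>a. r' m a - r'' m a) (tensor_indices B m))\<^sup>2) summable_on UNIV"
  shows "(\<lambda>m. (L2_set (\<lambda>a. r m a - r'' m a) (tensor_indices B m))\<^sup>2) summable_on UNIV"
    and "hilb_dist B r r'' \<le> hilb_dist B r r' + hilb_dist B r' r''"
proof -
  have "L2_set (\<lambda>m. L2_set (\<lambda>a. r m a - r'' m a) (tensor_indices B m)) {..<N}
      \<le> hilb_dist B r r' + hilb_dist B r' r''" for N
  proof -
    have "L2_set (\<lambda>m. L2_set (\<lambda>a. r m a - r'' m a) (tensor_indices B m)) {..<N}
      \<le> L2_set (\<lambda>m. L2_set (\<lambda>a. r m a - r' m a) (tensor_indices B m)
             + L2_set (\<lambda>a. r' m a - r'' m a) (tensor_indices B m)) {..<N}"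
      by (intro L2_set_mono L2_set_diff_triangle) auto
    also have "\<dots> \<le> hilb_dist B r r' + hilb_dist B r' r''"
      by (rule order_trans[OF L2_set_triangle_ineq add_mono[OF hilb_dist_ge[OF assms(1)] hilb_dist_ge[OF assms(2)]]])
    finally show ?thesis .
  qed
  note hilb_dist_le[OF this]
  then show "(\<lambda>m. (L2_set (\<lambda>a. r m a - r'' m a) (tensor_indices B m))\<^sup>2) summable_on UNIV"
    and "hilb_dist B r r'' \<le> hilb_dist B r r' + hilb_dist B r' r''" .
qed

lemma hilb_diff_summable:
  assumes "r \<in> hilb B" "r' \<in> hilb B"
  shows "(\<lambda>m. (L2_set (\<lambda>a. r m a - r' m a) (tensor_indices B m))\<^sup>2) summable_on UNIV"
  using hilb_dist_triangle'(1)[of r "\<lambda>_ _. 0" B r'] assms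
  by (simp add: hilb_def L2_set_def)

theorem Metric_space_hilb:
  assumes "finite B"
  shows "Metric_space (hilb B) (hilb_dist B :: (nat \<Rightarrow> ('d::finite, 'f) tensor_index \<Rightarrow> real) \<Rightarrow> _)"
proof
  fix r r' r'' :: "nat \<Rightarrow> ('d, 'f) tensor_index \<Rightarrow> real"
  show "0 \<le> hilb_dist B r r'" by (rule hilb_dist_nonneg)
  show "hilb_dist B r r' = hilb_dist B r' r" by (rule hilb_dist_commute)
  assume r: "r \<in> hilb B" and r': "r' \<in> hilb B"
  show "hilb_dist B r r' = 0 \<longleftrightarrow> r = r'"
  proof
    assume 0: "hilb_dist B r r' = 0"
    show "r = r'"
    proof (intro ext)
      fix m a
      have "L2_set (\<lambda>m. L2_set (\<lambda>a. r m a - r' m a) (tensor_indices B m)) {..<Suc m} = 0"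
        using hilb_dist_ge[OF hilb_diff_summable[OF r r'], of "Suc m"] unfolding 0
        by (intro antisym) auto
      then have "L2_set (\<lambda>a. r m a - r' m a) (tensor_indices B m) = 0"
        by (subst (asm) L2_set_eq_0_iff) auto
      then have "a \<in> tensor_indices B m \<Longrightarrow> r m a = r' m a"
        by (simp add: L2_set_eq_0_iff finite_tensor_indices[OF assms])
      moreover have "a \<notin> tensor_indices B m \<Longrightarrow> r m a = r' m a"
      proof -
        assume "a \<notin> tensor_indices B m"
        then have "r m a = 0" "r' m a = 0"
          using r r' unfolding hilb_def tensors_def by blast+
        then show "r m a = r' m a" by simp
      qed
      ultimately show "r m a = r' m a" by blast
    qed
  qed (simp add: hilb_dist_def L2_set_def)
  assume r'': "r'' \<in> hilb B"
  show "hilb_dist B r r'' \<le> hilb_dist B r r' + hilb_dist B r' r''"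
    by (rule hilb_dist_triangle'(2)[OF hilb_diff_summable[OF r r'] hilb_diff_summable[OF r' r'']])
qed

lemma AE_cube_iff:
  "(AE s in lebesgue_on (cbox 0 (1 :: real^'d::finite)). Q s) \<longleftrightarrow> (AE s in lborel. s \<in> cbox 0 1 \<longrightarrow> Q s)"
  by (subst AE_restrict_space_iff) (auto simp: AE_completion_iff)

lemma AE_PiM_lborel:
  fixes Q :: "'a::euclidean_space \<Rightarrow> bool"
  assumes "finite I" "i \<in> I" "AE s in lborel. Q s"
  shows "AE t in Pi\<^sub>M I (\<lambda>_. lborel). Q (t i)"
proof -
  interpret product_sigma_finite "\<lambda>_. lborel :: 'a measure"
    by unfold_locales
  obtain N where N: "{s. \<not> Q s} \<subseteq> N" "N \<in> null_sets lborel"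
    using assms(3) unfolding eventually_ae_filter by auto
  let ?A = "\<lambda>k. if k = i then N else UNIV"
  have A: "?A k \<in> sets lborel" for k
    using N(2) by (auto simp: null_sets_def)
  show ?thesis
  proof (rule AE_I')
    have "(\<Prod>k\<in>I. emeasure lborel (?A k)) = 0"
      using assms(1,2) N(2) by (intro prod_zero) (auto simp: null_sets_def)
    then show "PiE I ?A \<in> null_sets (Pi\<^sub>M I (\<lambda>_. lborel))"
      using assms(1) A by (simp add: null_sets_def emeasure_PiM sets_PiM_I_finite)
    show "{t \<in> space (Pi\<^sub>M I (\<lambda>_. lborel)). \<not> Q (t i)} \<subseteq> PiE I ?A"
      using N(1) by (auto simp: space_PiM PiE_def Pi_def)
  qed
qed

lemma sig_domain_cube:
  fixes t :: "nat \<Rightarrow> real^'d::finite"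
  assumes "t \<in> sig_domain m \<pi>" "\<And>j. \<pi> j permutes {1..m}" "i \<in> {1..m}"
  shows "t i \<in> cbox 0 1"
proof -
  have "0 \<le> t i $ j \<and> t i $ j \<le> 1" for j
  proof -
    define \<tau> where "\<tau> = (\<lambda>i. t i $ j)"
    have \<tau>: "0 \<le> \<tau> (\<pi> j 1)" "strict_mono_on {1..m} (\<tau> \<circ> \<pi> j)" "\<tau> (\<pi> j m) \<le> 1"
      using assms(1) by (auto simp: sig_domain_def order_simplex_def \<tau>_def)
    obtain k where k: "k \<in> {1..m}" "i = \<pi> j k"
      using assms(2)[of j] assms(3) permutes_image by (metis imageE)
    have "\<tau> (\<pi> j 1) \<le> \<tau> (\<pi> j k)" "\<tau> (\<pi> j k) \<le> \<tau> (\<pi> j m)"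
      using strict_mono_on_leD[OF \<tau>(2), of 1 k] strict_mono_on_leD[OF \<tau>(2), of k m] k by simp_all
    then show ?thesis using \<tau> k by (simp add: \<tau>_def)
  qed
  then show ?thesis by (simp add: mem_box_cart)
qed

lemma sets_sig_domain:
  fixes \<pi> :: "'d::finite \<Rightarrow> nat \<Rightarrow> nat"
  assumes "m \<ge> 1" "\<And>j. \<pi> j permutes {1..m}"
  shows "sig_domain m \<pi> \<in> sets (Pi\<^sub>M {1..m} (\<lambda>_. lborel :: (real^'d) measure))"
proof -
  let ?M = "Pi\<^sub>M {1..m} (\<lambda>_. lborel :: (real^'d) measure)"
  have in_set: "\<pi> j k \<in> {1..m}" if "k \<in> {1..m}" for j k
    using assms(2)[of j] that permutes_in_image by metis
  have c: "(\<lambda>t. t (\<pi> j k) $ j) \<in> borel_measurable ?M" if "k \<in> {1..m}" for j k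
  proof -
    have "(\<lambda>t. t (\<pi> j k)) \<in> measurable ?M lborel"
      using in_set[OF that] by (rule measurable_component_singleton)
    then have "(\<lambda>t. t (\<pi> j k)) \<in> borel_measurable ?M" by simp
    then show ?thesis by (rule measurable_compose[OF _ borel_measurable_nth])
  qed
  have le: "Measurable.pred ?M (\<lambda>t. f t \<le> g t)"
    if "f \<in> borel_measurable ?M" "g \<in> borel_measurable ?M" for f g :: "_ \<Rightarrow> real"
    using that unfolding pred_def by (rule borel_measurable_le)
  have "Measurable.pred ?M (\<lambda>t. \<forall>j\<in>UNIV. 0 \<le> t (\<pi> j 1) $ j \<and>
      (\<forall>a\<in>{1..m}. \<forall>b\<in>{1..m}. a < b \<longrightarrow> t (\<pi> j a) $ j < t (\<pi> j b) $ j) \<and> t (\<pi> j m) $ j \<le> 1)"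
    using assms(1)
    by (intro pred_intros_finite(3) pred_intros_logic(3) pred_intros_imp' borel_measurable_pred_less
        le c borel_measurable_const) auto
  moreover have "sig_domain m \<pi> = {t \<in> space ?M. \<forall>j\<in>UNIV. 0 \<le> t (\<pi> j 1) $ j \<and>
      (\<forall>a\<in>{1..m}. \<forall>b\<in>{1..m}. a < b \<longrightarrow> t (\<pi> j a) $ j < t (\<pi> j b) $ j) \<and> t (\<pi> j m) $ j \<le> 1}"
    by (auto simp: sig_domain_def order_simplex_def strict_mono_on_def space_PiM)
  ultimately show ?thesis by (simp only: pred_def)
qed

lemma bar_map_Lip:
  assumes "x \<in> Lip"
  shows "bar_map x \<in> Lip"
proof -
  obtain C where "C-lipschitz_on (cbox 0 1) x" using assms by (auto simp: Lip_def)
  then have "(sqrt (1\<^sup>2 + C\<^sup>2))-lipschitz_on (cbox 0 1) (\<lambda>s. (s, x s))"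
    by (intro lipschitz_on_Pair lipschitz_intros)
  then show ?thesis by (auto simp: Lip_def bar_map_def[abs_def])
qed

lemma borel_measurable_sig_integrand:
  fixes x :: "real^'d::{finite,linorder} \<Rightarrow> 'v::real_inner"
  assumes "x \<in> Lip" "m \<ge> 1" "\<And>j. \<pi> j permutes {1..m}"
  shows "(\<lambda>t. indicator (sig_domain m \<pi>) t *\<^sub>R (\<Prod>i\<in>{1..m}. jac_minor (bar_basis e) (bar_map x) (P i) (t i)))
           \<in> borel_measurable (Pi\<^sub>M {1..m} (\<lambda>_. lborel))"
proof -
  let ?M = "Pi\<^sub>M {1..m} (\<lambda>_. lborel :: (real, 'd) vec measure)"
  define G where "G i s = indicator (cbox 0 1) s *\<^sub>R jac_minor (bar_basis e) (bar_map x) (P i) s" for i s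
  have G: "G i \<in> borel_measurable lborel" for i
    using borel_measurable_jac_minor[OF bar_map_Lip[OF assms(1)], of "bar_basis e" "P i"]
    unfolding G_def by (subst (asm) borel_measurable_restrict_space_iff) auto
  have [measurable]: "(\<lambda>t. G i (t i)) \<in> borel_measurable ?M" if "i \<in> {1..m}" for i
    using G that by (intro measurable_compose[OF measurable_component_singleton]) auto
  note sets_sig_domain[OF assms(2,3), measurable]
  have meas: "(\<lambda>t. indicator (sig_domain m \<pi>) t *\<^sub>R (\<Prod>i\<in>{1..m}. G i (t i))) \<in> borel_measurable ?M"
    by measurable
  have "t i \<in> cbox 0 1" if "t \<in> sig_domain m \<pi>" "i \<in> {1..m}" for t i
    using that(1) assms(3) that(2) by (rule sig_domain_cube)
  then have "indicator (sig_domain m \<pi>) t *\<^sub>R (\<Prod>i\<in>{1..m}. G i (t i)) =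
      indicator (sig_domain m \<pi>) t *\<^sub>R (\<Prod>i\<in>{1..m}. jac_minor (bar_basis e) (bar_map x) (P i) (t i))" for t
    by (cases "t \<in> sig_domain m \<pi>") (simp_all add: G_def)
  with meas show ?thesis by (simp only:)
qed

lemma sig_coord_cong:
  fixes x y :: "(real, 'd::{finite,linorder}) vec \<Rightarrow> 'v::real_inner"
  assumes xy: "(x, y) \<in> jac_equiv e n" and "m \<ge> 1" and a: "a \<in> tensor_indices (W n) m"
  shows "sig_coord e x m a = sig_coord e y m a"
proof -
  define P \<pi> where "P = fst a" and "\<pi> = snd a"
  have Pp: "a = (P, \<pi>)" "\<And>i. i \<in> {1..m} \<Longrightarrow> P i \<in> W n" "\<And>j. \<pi> j permutes {1..m}"
    using a by (auto simp: tensor_indices_def P_def \<pi>_def simp del: One_nat_def)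
  let ?M = "Pi\<^sub>M {1..m} (\<lambda>_. lborel :: (real, 'd) vec measure)"
  let ?J = "\<lambda>x Q s. jac_minor (bar_basis e) (bar_map x) Q s"
  have L: "x \<in> Lip" "y \<in> Lip" using xy by (auto simp: jac_equiv_def)
  have "AE s in lborel. s \<in> cbox 0 1 \<longrightarrow> (\<forall>P\<in>ord_inj n. dhat e x s P = dhat e y s P)"
    using xy unfolding AE_cube_iff[symmetric] by (simp add: jac_equiv_def)
  then have "AE s in lborel. s \<in> cbox 0 1 \<longrightarrow> (\<forall>Q\<in>W n. ?J x Q s = ?J y Q s)"
    by eventually_elim (auto simp: W_def jac_minor_bar_U jac_minor_bar_P dhat_def)
  then have "AE t in ?M. \<forall>i\<in>{1..m}. t i \<in> cbox 0 1 \<longrightarrow> (\<forall>Q\<in>W n. ?J x Q (t i) = ?J y Q (t i))"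
    by (intro AE_finite_allI AE_PiM_lborel) auto
  then have "AE t in ?M. indicator (sig_domain m \<pi>) t *\<^sub>R (\<Prod>i\<in>{1..m}. ?J x (P i) (t i)) =
      indicator (sig_domain m \<pi>) t *\<^sub>R (\<Prod>i\<in>{1..m}. ?J y (P i) (t i))"
  proof eventually_elim
    case (elim t)
    have "t i \<in> cbox 0 1" if "t \<in> sig_domain m \<pi>" "i \<in> {1..m}" for i
      using that(1) Pp(3) that(2) by (rule sig_domain_cube)
    with elim Pp(2) have "(\<Prod>i\<in>{1..m}. ?J x (P i) (t i)) = (\<Prod>i\<in>{1..m}. ?J y (P i) (t i))"
      if "t \<in> sig_domain m \<pi>"
      using that by (intro prod.cong refl) blast
    then show ?case
      by (cases "t \<in> sig_domain m \<pi>") (simp_all del: One_nat_def)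
  qed
  moreover have "(\<lambda>t. indicator (sig_domain m \<pi>) t *\<^sub>R (\<Prod>i\<in>{1..m}. ?J z (P i) (t i))) \<in> borel_measurable ?M"
    if "z \<in> Lip" for z
    using that assms(2) Pp(3) by (rule borel_measurable_sig_integrand)
  ultimately show ?thesis
    unfolding sig_coord_def Pp(1) set_lebesgue_integral_def prod.case
    using L by (intro integral_cong_AE) simp_all
qed

theorem bar_Phi_eq:
  assumes "X \<in> LipJ e n" "x \<in> X"
  shows "bar_Phi e n X = bar_sig e n x"
proof -
  have "bar_sig e n y = bar_sig e n x" if "y \<in> X" for y
  proof (intro ext)
    fix m a
    show "bar_sig e n y m a = bar_sig e n x m a"
      using sig_coord_cong[OF LipJ_equiv[OF assms(1) that assms(2)], of m a]
      by (simp add: bar_sig_def)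
  qed
  then show ?thesis
    unfolding bar_Phi_def using assms(2) by (intro the_elem_image_eq)
qed

end

theory Submission
  imports Defs
begin

text \<open>
  Permuting the coordinates \<open>t\<^sub>1\<^sub>,\<^sub>j, \<dots>, t\<^sub>m\<^sub>,\<^sub>j\<close> separately for each \<open>j\<close> preserves Lebesgue measure.  Hence the
  \<open>(m!)\<^sup>d\<close> integration domains, which are disjoint subsets of the \<open>m\<close>-th power of the cube, all have the
  same measure, at most \<open>1 / (m!)\<^sup>d\<close>.  On them the integrands of two classes differ almost everywhere by
  at most \<open>m L\<^sup>m\<^sup>-\<^sup>1 \<mu>\<close>, by telescoping the product.  Squaring and summing this bound over
  the \<open>|W|\<^sup>m (m!)\<^sup>d\<close> coordinates of each level gives a convergent series because \<open>d \<ge> 1\<close>, so that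
  the signature is locally Lipschitz.
\<close>

section \<open>Invariance of Lebesgue measure under columnwise permutations\<close>

lemma emeasure_lborel_box_cart:
  fixes l u :: "real^'d::finite"
  shows "emeasure lborel (box l u) = (\<Prod>j\<in>UNIV. emeasure lborel {l $ j<..<u $ j})"
proof (cases "\<forall>j. l $ j \<le> u $ j")
  case True
  have "emeasure lborel (box l u) = ennreal (\<Prod>b\<in>Basis. (u - l) \<bullet> b)"
    using True by (intro emeasure_lborel_box) (auto simp: Basis_vec_def inner_axis)
  also have "(\<Prod>b\<in>Basis. (u - l) \<bullet> b) = (\<Prod>j\<in>UNIV. u $ j - l $ j)"
  proof -
    have inj: "inj (\<lambda>j. axis j 1 :: real^'d)"
      by (auto simp: inj_on_def axis_eq_axis)
    have basis: "Basis = range (\<lambda>j. axis j 1 :: real^'d)"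
      by (auto simp: Basis_vec_def)
    show ?thesis
      unfolding basis prod.reindex[OF inj] by (simp add: inner_axis)
  qed
  finally show ?thesis
    using True by (simp add: prod_ennreal)
next
  \<comment> \<open>An empty side contributes the factor 0. Covering this case makes the formula
    unconditional, so that it applies to every box of the generator used below, including empty
    ones.\<close>
  case False
  then obtain j where j: "u $ j < l $ j" by (auto simp: not_le)
  have "box l u = {}"
    using j by (meson all_not_in_conv less_asym less_trans mem_box_cart(1))
  moreover have "emeasure lborel {l $ j<..<u $ j} = 0" using j by simp
  then have "(\<Prod>j\<in>UNIV. emeasure lborel {l $ j<..<u $ j}) = 0"
    by (intro prod_zero) auto
  ultimately show ?thesis by simp
qed

text \<open>Each column \<open>j\<close> of the array of coordinates has its own permutation, so the
  vectors \<open>t i\<close> are torn apart and the map is not a mere relabelling of the factors of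
  the product space. Restricting to \<open>I\<close> keeps the values extensional, hence in the
  space of the product measure.\<close>

definition permute_coords ::
    "'i set \<Rightarrow> ('d::finite \<Rightarrow> 'i \<Rightarrow> 'i) \<Rightarrow> ('i \<Rightarrow> real^'d) \<Rightarrow> 'i \<Rightarrow> real^'d" where
  "permute_coords I \<pi> t = (\<lambda>i\<in>I. \<chi> j. t (\<pi> j i) $ j)"

lemma measurable_permute_coords:
  fixes \<pi> :: "'d::finite \<Rightarrow> 'i \<Rightarrow> 'i"
  assumes "\<And>j. \<pi> j permutes I"
  shows "permute_coords I \<pi> \<in> measurable (Pi\<^sub>M I (\<lambda>_. lborel)) (Pi\<^sub>M I (\<lambda>_. lborel))"
  unfolding permute_coords_def[abs_def]
proof (rule measurable_restrict)
  fix i assume i: "i \<in> I"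
  have "(\<lambda>t. t (\<pi> j i) $ j) \<in> borel_measurable (Pi\<^sub>M I (\<lambda>_. lborel :: (real^'d) measure))" for j
  proof -
    have "\<pi> j i \<in> I" using assms[of j] i by (simp add: permutes_in_image)
    then have "(\<lambda>t. t (\<pi> j i)) \<in> measurable (Pi\<^sub>M I (\<lambda>_. lborel)) (lborel :: (real^'d) measure)"
      by (rule measurable_component_singleton)
    then have "(\<lambda>t. t (\<pi> j i)) \<in> borel_measurable (Pi\<^sub>M I (\<lambda>_. lborel :: (real^'d) measure))" by simp
    then show ?thesis by (rule measurable_compose[OF _ borel_measurable_nth])
  qed
  then have "(\<lambda>t. \<chi> j. t (\<pi> j i) $ j) \<in> borel_measurable (Pi\<^sub>M I (\<lambda>_. lborel :: (real^'d) measure))"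
    by (subst borel_measurable_euclidean_space) (auto simp: Basis_vec_def inner_axis)
  then show "(\<lambda>t. \<chi> j. t (\<pi> j i) $ j) \<in> measurable (Pi\<^sub>M I (\<lambda>_. lborel)) (lborel :: (real^'d) measure)"
    by simp
qed

text \<open>Membership in a product of boxes is a conjunction of conditions on single coordinates,
  one for each pair of \<open>i\<close> and \<open>j\<close>. For fixed \<open>j\<close>, the
  bijection \<open>\<pi> j\<close> of \<open>I\<close> moves the condition on
  \<open>t (\<pi> j i) $ j\<close> to the row \<open>\<pi> j i\<close>, which therefore carries the
  bounds of the row found by the inverse.\<close>

lemma permute_coords_vimage_boxes:
  fixes \<pi> :: "'d::finite \<Rightarrow> 'i \<Rightarrow> 'i"
  assumes \<pi>: "\<And>j. \<pi> j permutes I"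
  shows "permute_coords I \<pi> -` (\<Pi>\<^sub>E i\<in>I. box (l i) (u i)) \<inter> (I \<rightarrow>\<^sub>E UNIV) =
    (\<Pi>\<^sub>E i\<in>I. box (\<chi> j. l (inv (\<pi> j) i) $ j) (\<chi> j. u (inv (\<pi> j) i) $ j))"
proof -
  have "(\<forall>i\<in>I. Q j i (\<pi> j i)) \<longleftrightarrow> (\<forall>i\<in>I. Q j (inv (\<pi> j) i) i)" for Q :: "'d \<Rightarrow> 'i \<Rightarrow> 'i \<Rightarrow> bool" and j
    using \<pi>[of j] permutes_inv[OF \<pi>[of j]]
    by (metis permutes_in_image permutes_inverses)
  from this[of "\<lambda>j k i. l k $ j < t i $ j \<and> t i $ j < u k $ j" for t]
  have "(\<forall>i\<in>I. \<forall>j. l i $ j < t (\<pi> j i) $ j \<and> t (\<pi> j i) $ j < u i $ j) \<longleftrightarrow>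
      (\<forall>i\<in>I. \<forall>j. l (inv (\<pi> j) i) $ j < t i $ j \<and> t i $ j < u (inv (\<pi> j) i) $ j)" for t
    by meson
  then show ?thesis
    by (auto simp: permute_coords_def PiE_iff mem_box_cart)
qed

text \<open>Products of boxes are the right generator here: they are closed under intersection, and
  their preimages under \<open>permute_coords\<close> are again products of boxes, which fails for
  products of arbitrary Borel sets.\<close>

lemma sets_PiM_lborel_boxes:
  assumes "finite I"
  shows "sets (Pi\<^sub>M I (\<lambda>_. lborel :: 'a::euclidean_space measure)) =
    sigma_sets (I \<rightarrow>\<^sub>E UNIV) (range (\<lambda>(l, u). \<Pi>\<^sub>E i\<in>I. box (l i) (u i)))"
proof -
  let ?B = "range (\<lambda>(l, u). box l u :: 'a set)"
  have cover: "\<exists>S\<subseteq>?B. countable S \<and> UNIV = \<Union>S"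
    using UN_box_eq_UNIV
    by (intro exI[of _ "range (\<lambda>n::nat. box (- (real n *\<^sub>R One)) (real n *\<^sub>R One))"]) auto
  \<comment> \<open>The general description of product sigma-algebras uses a family of finite blocks
    covering the index set. With \<open>I\<close> as the only block, its generator consists of the
    full products.\<close>
  have gen: "{{f \<in> I \<rightarrow>\<^sub>E UNIV. \<forall>i\<in>j. f i \<in> A i} |A j. j \<in> {I} \<and> A \<in> Pi j (\<lambda>_. ?B)} =
      range (\<lambda>(l, u). \<Pi>\<^sub>E i\<in>I. box (l i) (u i))"
  proof (intro set_eqI iffI)
    fix X assume "X \<in> {{f \<in> I \<rightarrow>\<^sub>E UNIV. \<forall>i\<in>j. f i \<in> A i} |A j. j \<in> {I} \<and> A \<in> Pi j (\<lambda>_. ?B)}"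
    then obtain A where A: "X = {f \<in> I \<rightarrow>\<^sub>E UNIV. \<forall>i\<in>I. f i \<in> A i}" "A \<in> I \<rightarrow> ?B"
      by auto
    have "\<exists>p. A i = box (fst p) (snd p)" if "i \<in> I" for i
      using funcset_mem[OF A(2) that] by auto
    then obtain p where "\<And>i. i \<in> I \<Longrightarrow> A i = box (fst (p i)) (snd (p i))"
      by metis
    then have "X = (\<Pi>\<^sub>E i\<in>I. box (fst (p i)) (snd (p i)))"
      unfolding A(1) by (auto simp: PiE_iff extensional_def)
    then show "X \<in> range (\<lambda>(l, u). \<Pi>\<^sub>E i\<in>I. box (l i) (u i))"
      by (intro image_eqI[of _ _ "(\<lambda>i. fst (p i), \<lambda>i. snd (p i))"]) auto
  next
    fix X assume "X \<in> range (\<lambda>(l, u). \<Pi>\<^sub>E i\<in>I. box (l i) (u i :: 'a))"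
    then obtain l u where X: "X = (\<Pi>\<^sub>E i\<in>I. box (l i) (u i :: 'a))" by auto
    show "X \<in> {{f \<in> I \<rightarrow>\<^sub>E UNIV. \<forall>i\<in>j. f i \<in> A i} |A j. j \<in> {I} \<and> A \<in> Pi j (\<lambda>_. ?B)}"
      unfolding X
      by (intro CollectI exI[of _ "\<lambda>i. box (l i) (u i)"] exI[of _ I]) (auto simp: PiE_iff extensional_def)
  qed
  have "sets (Pi\<^sub>M I (\<lambda>_. lborel :: 'a measure)) = sets (Pi\<^sub>M I (\<lambda>_. sigma UNIV ?B))"
    by (intro sets_PiM_cong) (auto simp: borel_eq_box)
  also have "\<dots> = sets (sigma (I \<rightarrow>\<^sub>E UNIV)
      {{f \<in> I \<rightarrow>\<^sub>E UNIV. \<forall>i\<in>j. f i \<in> A i} |A j. j \<in> {I} \<and> A \<in> Pi j (\<lambda>_. ?B)})"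
    by (rule sets_PiM_sigma) (use cover assms in auto)
  also have "\<dots> = sigma_sets (I \<rightarrow>\<^sub>E UNIV) (range (\<lambda>(l, u). \<Pi>\<^sub>E i\<in>I. box (l i) (u i)))"
    unfolding gen by (intro sets_measure_of) (auto simp: PiE_iff)
  finally show ?thesis .
qed

text \<open>By uniqueness of measures it suffices to compare both sides on products of boxes,
  growing cubes of finite measure exhausting the space. There the measure is a product of side
  lengths over all \<open>i\<close> and \<open>j\<close>, and the permutation only reorders the
  factors within each column.\<close>

lemma distr_permute_coords:
  fixes \<pi> :: "'d::finite \<Rightarrow> 'i \<Rightarrow> 'i"
  assumes I: "finite I" and \<pi>: "\<And>j. \<pi> j permutes I"
  defines "M \<equiv> Pi\<^sub>M I (\<lambda>_. lborel :: (real^'d) measure)"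
  shows "distr M M (permute_coords I \<pi>) = M"
proof (rule sym, rule measure_eqI_generator_eq)
  interpret product_sigma_finite "\<lambda>_. lborel :: (real^'d) measure" by unfold_locales
  let ?E = "range (\<lambda>(l, u). \<Pi>\<^sub>E i\<in>I. box (l i) (u i)) :: ('i \<Rightarrow> real^'d) set set"
  show "Int_stable ?E"
  proof (rule Int_stableI_image, clarsimp)
    fix l u l' u' :: "'i \<Rightarrow> real^'d"
    show "\<exists>l'' u''. (\<Pi>\<^sub>E i\<in>I. box (l i) (u i)) \<inter> (\<Pi>\<^sub>E i\<in>I. box (l' i) (u' i)) = (\<Pi>\<^sub>E i\<in>I. box (l'' i) (u'' i))"
      by (intro exI[of _ "\<lambda>i. \<chi> j. max (l i $ j) (l' i $ j)"] exI[of _ "\<lambda>i. \<chi> j. min (u i $ j) (u' i $ j)"])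
        (auto simp: PiE_Int PiE_iff mem_box_cart)
  qed
  show "?E \<subseteq> Pow (I \<rightarrow>\<^sub>E UNIV)" by (auto simp: PiE_iff)
  show "sets M = sigma_sets (I \<rightarrow>\<^sub>E UNIV) ?E"
    unfolding M_def by (rule sets_PiM_lborel_boxes[OF I])
  then show "sets (distr M M (permute_coords I \<pi>)) = sigma_sets (I \<rightarrow>\<^sub>E UNIV) ?E" by simp
  let ?A = "\<lambda>n::nat. (\<Pi>\<^sub>E i\<in>I. box (- (real n *\<^sub>R One)) (real n *\<^sub>R One)) :: ('i \<Rightarrow> real^'d) set"
  show "range ?A \<subseteq> ?E" by auto
  show "(\<Union>n. ?A n) = (I \<rightarrow>\<^sub>E UNIV)"
  proof (intro equalityI subsetI)
    fix t :: "'i \<Rightarrow> real^'d" assume t: "t \<in> I \<rightarrow>\<^sub>E UNIV"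
    have "\<exists>n::nat. t i \<in> box (- (real n *\<^sub>R One)) (real n *\<^sub>R One)" for i
    proof -
      have "t i \<in> (\<Union>n::nat. box (- (real n *\<^sub>R One)) (real n *\<^sub>R One))"
        unfolding UN_box_eq_UNIV by simp
      then show ?thesis by blast
    qed
    then obtain N :: "'i \<Rightarrow> nat" where N: "\<And>i. t i \<in> box (- (real (N i) *\<^sub>R One)) (real (N i) *\<^sub>R One)"
      by metis
    \<comment> \<open>Since \<open>I\<close> is finite, the sum of the individual radii is a radius
      that serves all rows at once.\<close>
    have "t i \<in> box (- (real (\<Sum>i\<in>I. N i) *\<^sub>R One)) (real (\<Sum>i\<in>I. N i) *\<^sub>R One)" if "i \<in> I" for i
    proof -
      have "real (N i) \<le> real (\<Sum>i\<in>I. N i)"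
        using member_le_sum[of i I N] that I by (simp only: of_nat_le_iff)
      with N[of i] show ?thesis by (fastforce simp: mem_box)
    qed
    then have "t \<in> ?A (\<Sum>i\<in>I. N i)"
      using t by (intro PiE_I) (auto simp: PiE_iff extensional_def)
    then show "t \<in> (\<Union>n. ?A n)" by blast
  qed (auto simp: PiE_iff)
  show "emeasure M (?A n) \<noteq> \<infinity>" for n
    unfolding M_def using I
    by (subst emeasure_PiM) (auto simp: power_eq_top_ennreal emeasure_lborel_box_finite[THEN less_imp_neq])
  fix X assume "X \<in> ?E"
  then obtain l u :: "'i \<Rightarrow> real^'d" where X: "X = (\<Pi>\<^sub>E i\<in>I. box (l i) (u i))" by auto
  have sp: "space M = (I \<rightarrow>\<^sub>E UNIV)" by (simp add: M_def space_PiM)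
  have "X \<in> sets M" unfolding X M_def by (intro sets_PiM_I_finite I) auto
  then have "emeasure (distr M M (permute_coords I \<pi>)) X =
      emeasure M (\<Pi>\<^sub>E i\<in>I. box (\<chi> j. l (inv (\<pi> j) i) $ j) (\<chi> j. u (inv (\<pi> j) i) $ j))"
    using measurable_permute_coords[of \<pi> I, OF \<pi>] permute_coords_vimage_boxes[where \<pi> = \<pi> and I = I and l = l and u = u, OF \<pi>]
    by (subst emeasure_distr) (simp_all add: sp X M_def[symmetric])
  \<comment> \<open>Exchanging the two products collects the factors of one column, so that each
    column can be reindexed by its own permutation.\<close>
  also have "\<dots> = (\<Prod>j\<in>UNIV. \<Prod>i\<in>I. emeasure lborel {l (inv (\<pi> j) i) $ j<..<u (inv (\<pi> j) i) $ j})"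
    unfolding M_def using I by (subst emeasure_PiM) (auto simp: emeasure_lborel_box_cart intro: prod.swap)
  also have "\<dots> = (\<Prod>j\<in>UNIV. \<Prod>i\<in>I. emeasure lborel {l i $ j<..<u i $ j})"
  proof (rule prod.cong[OF refl])
    fix j
    show "(\<Prod>i\<in>I. emeasure lborel {l (inv (\<pi> j) i) $ j<..<u (inv (\<pi> j) i) $ j}) =
        (\<Prod>i\<in>I. emeasure lborel {l i $ j<..<u i $ j})"
      using prod.permute[OF permutes_inv[OF \<pi>[of j]], of "\<lambda>i. emeasure lborel {l i $ j<..<u i $ j}"]
      by (simp only: comp_def)
  qed
  also have "\<dots> = emeasure M X"
    unfolding M_def X using I by (subst emeasure_PiM) (auto simp: emeasure_lborel_box_cart intro: prod.swap)
  finally show "emeasure M X = emeasure (distr M M (permute_coords I \<pi>)) X" by simp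
qed

section \<open>Volume of the integration domains\<close>

lemma permute_coords_sig_domain_iff:
  fixes \<pi> :: "'d::finite \<Rightarrow> nat \<Rightarrow> nat"
  assumes "m \<ge> 1" and \<pi>: "\<And>j. \<pi> j permutes {1..m}" and t: "t \<in> {1..m} \<rightarrow>\<^sub>E UNIV"
  shows "permute_coords {1..m} \<pi> t \<in> sig_domain m (\<lambda>_. id) \<longleftrightarrow> t \<in> sig_domain m \<pi>"
proof -
  \<comment> \<open>From \<open>m \<ge> 1\<close> the end indices \<open>1\<close> and
    \<open>m\<close> lie in \<open>{1..m}\<close>, where the restricted array takes its proper
    values.\<close>
  have "(\<lambda>i. permute_coords {1..m} \<pi> t i $ j) \<in> order_simplex m id \<longleftrightarrow> (\<lambda>i. t i $ j) \<in> order_simplex m (\<pi> j)" for j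
    using assms(1) by (simp add: order_simplex_def permute_coords_def strict_mono_on_def)
  moreover have "permute_coords {1..m} \<pi> t \<in> {1..m} \<rightarrow>\<^sub>E UNIV"
    by (simp add: permute_coords_def)
  ultimately show ?thesis
    using t by (simp add: sig_domain_def)
qed

text \<open>Both permutations list the set of values of \<open>\<tau>\<close> in strictly increasing
  order, and a strictly sorted list is determined by its set. As \<open>\<tau>\<close> is injective
  on \<open>{1..m}\<close>, equal values mean equal indices. This makes the integration domains
  pairwise disjoint.\<close>

lemma order_simplex_unique:
  assumes \<tau>: "\<tau> \<in> order_simplex m \<sigma>" "\<tau> \<in> order_simplex m \<sigma>'"
    and \<sigma>: "\<sigma> permutes {1..m}" and \<sigma>': "\<sigma>' permutes {1..m}"
  shows "\<sigma> = \<sigma>'"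
proof -
  have mono: "strict_mono_on {1..m} (\<tau> \<circ> \<sigma>)" "strict_mono_on {1..m} (\<tau> \<circ> \<sigma>')"
    using \<tau> by (auto simp: order_simplex_def)
  have inj: "inj_on \<tau> {1..m}"
    using strict_mono_on_imp_inj_on[OF mono(1)] permutes_image[OF \<sigma>] inj_on_imageI by metis
  have sorted: "sorted_wrt (<) (map f [1..<Suc m])" if "strict_mono_on {1..m} f" for f :: "nat \<Rightarrow> real"
    unfolding sorted_wrt_map
    by (rule sorted_wrt_mono_rel[OF _ sorted_wrt_upt]) (use that in \<open>auto simp: strict_mono_on_def\<close>)
  have set: "{1..<Suc m} = {1..m}" by auto
  have "set (map (\<tau> \<circ> \<sigma>) [1..<Suc m]) = \<tau> ` {1..m}" "set (map (\<tau> \<circ> \<sigma>') [1..<Suc m]) = \<tau> ` {1..m}"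
    using permutes_image[OF \<sigma>] permutes_image[OF \<sigma>']
    by (simp_all only: set_map set_upt set image_comp[symmetric])
  then have "map (\<tau> \<circ> \<sigma>) [1..<Suc m] = map (\<tau> \<circ> \<sigma>') [1..<Suc m]"
    using strict_sorted_equal[OF sorted[OF mono(1)] sorted[OF mono(2)]] by (simp del: upt_Suc)
  then have eq: "\<tau> (\<sigma> i) = \<tau> (\<sigma>' i)" if "i \<in> {1..m}" for i
    using that by (simp add: set del: upt_Suc)
  show ?thesis
  proof
    fix i show "\<sigma> i = \<sigma>' i"
    proof (cases "i \<in> {1..m}")
      case True
      then show ?thesis
        using inj_onD[OF inj eq[OF True]] permutes_in_image[OF \<sigma>] permutes_in_image[OF \<sigma>'] by blast
    qed (use \<sigma> \<sigma>' in \<open>simp add: permutes_not_in\<close>)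
  qed
qed

lemma emeasure_sig_domain_le:
  fixes \<pi> :: "'d::finite \<Rightarrow> nat \<Rightarrow> nat"
  assumes m: "m \<ge> 1" and \<pi>: "\<And>j. \<pi> j permutes {1..m}"
  shows "emeasure (Pi\<^sub>M {1..m} (\<lambda>_. lborel :: (real^'d) measure)) (sig_domain m \<pi>) \<le> ennreal (1 / fact m ^ CARD('d))"
proof -
  interpret product_sigma_finite "\<lambda>_. lborel :: (real^'d) measure" by unfold_locales
  define M where "M = Pi\<^sub>M {1..m} (\<lambda>_. lborel :: (real^'d) measure)"
  define S where "S = {\<pi> :: 'd \<Rightarrow> nat \<Rightarrow> nat. \<forall>j. \<pi> j permutes {1..m}}"
  have sets: "sig_domain m \<rho> \<in> sets M" if "\<rho> \<in> S" for \<rho>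
    using that sets_sig_domain[OF m, of \<rho>] by (simp add: M_def S_def)
  have same: "emeasure M (sig_domain m \<rho>) = emeasure M (sig_domain m (\<lambda>_. id))" if "\<rho> \<in> S" for \<rho>
  proof -
    have \<rho>: "\<rho> j permutes {1..m}" for j using that by (simp add: S_def)
    have id: "sig_domain m (\<lambda>_::'d. id) \<in> sets M" by (rule sets) (simp add: S_def permutes_id)
    have "sig_domain m \<rho> \<subseteq> space M" by (auto simp: sig_domain_def M_def space_PiM)
    moreover have "permute_coords {1..m} \<rho> t \<in> sig_domain m (\<lambda>_. id) \<longleftrightarrow> t \<in> sig_domain m \<rho>"
      if "t \<in> space M" for t
      by (rule permute_coords_sig_domain_iff[OF m \<rho>]) (use that in \<open>simp add: M_def space_PiM\<close>)
    ultimately have "permute_coords {1..m} \<rho> -` sig_domain m (\<lambda>_. id) \<inter> space M = sig_domain m \<rho>"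
      by blast
    moreover have "emeasure (distr M M (permute_coords {1..m} \<rho>)) (sig_domain m (\<lambda>_. id)) =
        emeasure M (permute_coords {1..m} \<rho> -` sig_domain m (\<lambda>_. id) \<inter> space M)"
      using measurable_permute_coords[of \<rho>, OF \<rho>] id by (intro emeasure_distr) (simp_all add: M_def)
    moreover have "distr M M (permute_coords {1..m} \<rho>) = M"
      using distr_permute_coords[of _ \<rho>, OF _ \<rho>] by (simp add: M_def)
    ultimately show ?thesis by simp
  qed
  have S: "S = (UNIV \<rightarrow>\<^sub>E {\<sigma>. \<sigma> permutes {1..m}})" by (auto simp: S_def)
  have fin: "finite S" unfolding S by (simp add: finite_PiE finite_permutations)
  have card: "card S = fact m ^ CARD('d)"
    unfolding S by (subst card_PiE) (simp_all add: card_permutations)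
  have disj: "disjoint_family_on (sig_domain m) S"
  proof (unfold disjoint_family_on_def, intro ballI impI equals0I)
    fix \<rho> \<rho>' t assume *: "\<rho> \<in> S" "\<rho>' \<in> S" "\<rho> \<noteq> \<rho>'" "t \<in> sig_domain m \<rho> \<inter> sig_domain m \<rho>'"
    have "\<rho> j = \<rho>' j" for j
      using * by (intro order_simplex_unique[of "\<lambda>i. t i $ j" m]) (auto simp: S_def sig_domain_def)
    with *(3) show False by auto
  qed
  have "\<pi> \<in> S" using \<pi> by (simp add: S_def)
  then have "emeasure M (sig_domain m \<pi>) * of_nat (card S) =
      (\<Sum>\<rho>\<in>S. emeasure M (sig_domain m (\<lambda>_. id)))"
    by (simp only: same sum_constant mult.commute)
  also have "\<dots> = (\<Sum>\<rho>\<in>S. emeasure M (sig_domain m \<rho>))"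
    by (intro sum.cong refl same[symmetric])
  also have "\<dots> = emeasure M (\<Union>\<rho>\<in>S. sig_domain m \<rho>)"
    using sets fin disj by (intro sum_emeasure) auto
  also have "\<dots> \<le> emeasure M (\<Pi>\<^sub>E i\<in>{1..m}. cbox 0 1)"
  proof (rule emeasure_mono)
    show "(\<Union>\<rho>\<in>S. sig_domain m \<rho>) \<subseteq> (\<Pi>\<^sub>E i\<in>{1..m}. cbox 0 1)"
    proof (intro UN_least subsetI PiE_I)
      fix \<rho> t i assume *: "\<rho> \<in> S" "t \<in> sig_domain m \<rho>"
      then show "i \<in> {1..m} \<Longrightarrow> t i \<in> cbox 0 1"
        using sig_domain_cube[of t m \<rho> i] by (simp add: S_def)
      show "i \<notin> {1..m} \<Longrightarrow> t i = undefined"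
        using * by (auto simp: sig_domain_def PiE_iff extensional_def)
    qed
  qed (auto simp: M_def intro!: sets_PiM_I_finite)
  also have "\<dots> = 1"
  proof -
    have "emeasure lborel (cbox 0 (1 :: real^'d)) = 1"
      by (subst emeasure_lborel_cbox) (auto simp: Basis_vec_def inner_axis intro: prod.neutral)
    then show ?thesis by (simp add: M_def emeasure_PiM)
  qed
  finally have "emeasure M (sig_domain m \<pi>) * ennreal (fact m ^ CARD('d)) \<le> 1"
    by (simp only: ennreal_of_nat_eq_real_of_nat card of_nat_power of_nat_fact)
  \<comment> \<open>Division in the extended nonnegative reals is carried out by multiplying with
    the reciprocal of the finite positive constant.\<close>
  then have "emeasure M (sig_domain m \<pi>) * ennreal (fact m ^ CARD('d)) * ennreal (1 / fact m ^ CARD('d))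
      \<le> 1 * ennreal (1 / fact m ^ CARD('d))"
    by (rule mult_right_mono) simp
  moreover have "ennreal (fact m ^ CARD('d)) * ennreal (1 / fact m ^ CARD('d)) = 1"
    by (subst ennreal_mult[symmetric]) simp_all
  ultimately show ?thesis
    by (simp add: M_def mult.assoc)
qed

section \<open>Bounds for products, integrals and Jacobian minors\<close>

lemma abs_prod_diff_le:
  fixes a b :: "'i \<Rightarrow> real"
  assumes "L > 0" and "\<And>i. i \<in> I \<Longrightarrow> \<bar>a i\<bar> \<le> L" and "\<And>i. i \<in> I \<Longrightarrow> \<bar>b i\<bar> \<le> L"
    and "\<And>i. i \<in> I \<Longrightarrow> \<bar>a i - b i\<bar> \<le> \<delta>"
  shows "\<bar>prod a I - prod b I\<bar> \<le> real (card I) * L ^ (card I - 1) * \<delta>"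
proof (cases "card I = 0")
  \<comment> \<open>This covers infinite \<open>I\<close> as well, where both products are 1 by
    convention.\<close>
  case True
  then have "prod a I = prod b I"
    by (auto simp: card_eq_0_iff)
  then show ?thesis using True by simp
next
  case False
  \<comment> \<open>Dividing by \<open>L\<close> brings all factors into the unit interval around 0,
    where \<open>norm_prod_diff\<close> bounds the difference of the products by the sum of the
    differences. Scaling back, one power of \<open>L\<close> cancels against
    \<open>\<delta> / L\<close>.\<close>
  have scale: "prod f I = L ^ card I * (\<Prod>i\<in>I. f i / L)" for f
    using assms(1) by (simp add: prod_dividef)
  have "\<bar>(\<Prod>i\<in>I. a i / L) - (\<Prod>i\<in>I. b i / L)\<bar> \<le> (\<Sum>i\<in>I. \<bar>a i / L - b i / L\<bar>)"
    using norm_prod_diff[of I "\<lambda>i. a i / L" "\<lambda>i. b i / L"] assms(1-3) by simp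
  also have "\<dots> \<le> (\<Sum>i\<in>I. \<delta> / L)"
    using assms(1,4) by (intro sum_mono) (simp add: divide_right_mono flip: diff_divide_distrib)
  finally have "L ^ card I * \<bar>(\<Prod>i\<in>I. a i / L) - (\<Prod>i\<in>I. b i / L)\<bar> \<le> L ^ card I * (real (card I) * (\<delta> / L))"
    using assms(1) by (intro mult_left_mono) simp_all
  moreover have "L ^ card I = L ^ (card I - 1) * L"
    using False by (simp add: power_eq_if)
  ultimately show ?thesis
    unfolding scale[of a] scale[of b] right_diff_distrib[symmetric] abs_mult
    using assms(1) by (simp add: mult_ac)
qed

text \<open>Measurability is asked only of \<open>f\<close> cut off to \<open>D\<close>, and the
  bound only almost everywhere on \<open>D\<close>, because the minors are controlled only on the
  cube and, in terms of the essential supremum, only up to null sets.\<close>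

lemma set_integral_abs_le:
  fixes f :: "'a \<Rightarrow> real"
  assumes D: "D \<in> sets M" and f: "(\<lambda>t. indicator D t *\<^sub>R f t) \<in> borel_measurable M"
    and bnd: "AE t in M. t \<in> D \<longrightarrow> \<bar>f t\<bar> \<le> c" and v: "emeasure M D \<le> ennreal v" and "0 \<le> c" "0 \<le> v"
  shows "set_integrable M D f" and "\<bar>set_lebesgue_integral M D f\<bar> \<le> c * v"
proof -
  have fin: "emeasure M D < \<infinity>"
    using v by (rule order_le_less_trans) simp
  show int: "set_integrable M D f"
    unfolding set_integrable_def using bnd
    by (intro integrableI_bounded_set[OF D f fin, where B = c]) (auto elim: eventually_mono)
  have c: "integrable M (\<lambda>t. indicator D t * c)"
    using D fin by (intro integrable_mult_left integrable_real_indicator)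
  have "\<bar>set_lebesgue_integral M D f\<bar> \<le> (\<integral>t. norm (indicator D t *\<^sub>R f t) \<partial>M)"
    unfolding set_lebesgue_integral_def using integral_norm_bound[of M "\<lambda>t. indicator D t *\<^sub>R f t"] by simp
  also have "\<dots> \<le> (\<integral>t. indicator D t * c \<partial>M)"
    using int[unfolded set_integrable_def] c bnd
    by (intro integral_mono_AE integrable_norm) (auto simp: indicator_def elim!: eventually_mono)
  also have "\<dots> = measure M D * c"
    using D fin by simp
  also have "\<dots> \<le> c * v"
    using v assms(5,6) by (simp add: mult.commute[of _ c] mult_left_mono measure_def enn2real_leI)
  finally show "\<bar>set_lebesgue_integral M D f\<bar> \<le> c * v" .
qed

text \<open>The index \<open>Inl\<close> has minor 1, which explains the maximum with 1. Any other
  minor is a coordinate of \<open>dhat\<close> and hence at most its Euclidean norm.\<close>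

lemma AE_bar_minor_le:
  fixes x :: "real^'d::{finite,linorder} \<Rightarrow> 'v::real_inner"
  assumes "x \<in> Lip"
  shows "AE s in lborel. s \<in> cbox 0 1 \<longrightarrow>
    (\<forall>Q\<in>W n. \<bar>jac_minor (bar_basis e) (bar_map x) Q s\<bar> \<le> max (Linf_norm n (dhat e x)) 1)"
  using norm_rep(2)[OF assms assms, where e = e and n = n] unfolding AE_cube_iff
proof eventually_elim
  case (elim s)
  show ?case
  proof (intro impI ballI)
    fix Q :: "'d \<Rightarrow> 'd + nat" assume s: "s \<in> cbox 0 1" and "Q \<in> W n"
    then consider "Q = Inl" | P where "Q = Inr \<circ> P" "P \<in> ord_inj n"
      by (auto simp: W_def)
    then show "\<bar>jac_minor (bar_basis e) (bar_map x) Q s\<bar> \<le> max (Linf_norm n (dhat e x)) 1"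
    proof cases
      case 1
      then show ?thesis by (simp add: jac_minor_bar_U[OF s])
    next
      case 2
      have "dhat e x s P \<le> L2_set (dhat e x s) (ord_inj n)" "- dhat e x s P \<le> L2_set (dhat e x s) (ord_inj n)"
        using member_le_L2_set[OF finite_ord_inj 2(2), of "\<lambda>P. \<bar>dhat e x s P\<bar>"]
        by (simp_all add: L2_set_def)
      then show ?thesis
        using elim s unfolding 2(1) jac_minor_bar_P by (simp add: dhat_def)
    qed
  qed
qed

text \<open>No maximum with 1 appears here, since the minors of \<open>Inl\<close> are the same for
  both maps and cancel.\<close>

lemma AE_bar_minor_diff_le:
  fixes x y :: "(real, 'd::{finite,linorder}) vec \<Rightarrow> 'v::real_inner"
  assumes "x \<in> Lip" "y \<in> Lip"
  shows "AE s in lborel. s \<in> cbox 0 1 \<longrightarrow>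
    (\<forall>Q\<in>W n. \<bar>jac_minor (bar_basis e) (bar_map x) Q s - jac_minor (bar_basis e) (bar_map y) Q s\<bar> \<le> mu_rep e n x y)"
  using mu_rep(2)[OF assms, where e = e and n = n] unfolding AE_cube_iff
proof eventually_elim
  case (elim s)
  show ?case
  proof (intro impI ballI)
    fix Q :: "'d \<Rightarrow> 'd + nat" assume s: "s \<in> cbox 0 1" and "Q \<in> W n"
    then consider "Q = Inl" | P where "Q = Inr \<circ> P" "P \<in> ord_inj n"
      by (auto simp: W_def)
    then show "\<bar>jac_minor (bar_basis e) (bar_map x) Q s - jac_minor (bar_basis e) (bar_map y) Q s\<bar> \<le> mu_rep e n x y"
    proof cases
      case 1
      then show ?thesis using mu_rep(1)[OF assms, where e = e and n = n] by (simp add: jac_minor_bar_U[OF s])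
    next
      case 2
      let ?d = "\<lambda>P. dhat e x s P - dhat e y s P"
      have "?d P \<le> L2_set ?d (ord_inj n)" "- ?d P \<le> L2_set ?d (ord_inj n)"
        using member_le_L2_set[OF finite_ord_inj 2(2), of "\<lambda>P. \<bar>?d P\<bar>"]
        by (simp_all add: L2_set_def)
      then show ?thesis
        using elim s unfolding 2(1) jac_minor_bar_P by (simp add: dhat_def)
    qed
  qed
qed

text \<open>A null set of points \<open>s\<close> pulls back to a null set under each of the
  finitely many projections \<open>t i\<close>, and every row of a point of the domain lies in the
  cube.\<close>

lemma AE_sig_domain:
  assumes "AE s in lborel. s \<in> cbox 0 1 \<longrightarrow> Q s" and \<pi>: "\<And>j. \<pi> j permutes {1..m}"
  shows "AE t in Pi\<^sub>M {1..m} (\<lambda>_. lborel :: (real^'d::finite) measure). t \<in> sig_domain m \<pi> \<longrightarrow> (\<forall>i\<in>{1..m}. Q (t i))"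
proof -
  have "AE t in Pi\<^sub>M {1..m} (\<lambda>_. lborel :: (real, 'd) vec measure). \<forall>i\<in>{1..m}. t i \<in> cbox 0 1 \<longrightarrow> Q (t i)"
    using assms(1) by (intro AE_finite_allI AE_PiM_lborel) auto
  then show ?thesis
  proof eventually_elim
    case (elim t)
    then show ?case using sig_domain_cube[of t m \<pi>, OF _ \<pi>] by blast
  qed
qed

section \<open>Estimates for single signature coordinates\<close>

lemma tensor_indicesD:
  assumes "(P, \<pi>) \<in> tensor_indices B m"
  shows "\<And>i. i \<in> {1..m} \<Longrightarrow> P i \<in> B" "\<And>j. \<pi> j permutes {1..m}"
  using assms by (auto simp: tensor_indices_def simp del: One_nat_def)

lemma sig_coord_le:
  fixes x :: "real^'d::{finite,linorder} \<Rightarrow> 'v::real_inner"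
  assumes x: "x \<in> Lip" and m: "m \<ge> 1" and a: "(P, \<pi>) \<in> tensor_indices (W n) m"
    and L: "max (Linf_norm n (dhat e x)) 1 \<le> L"
  shows "set_integrable (Pi\<^sub>M {1..m} (\<lambda>_. lborel)) (sig_domain m \<pi>)
           (\<lambda>t. \<Prod>i\<in>{1..m}. jac_minor (bar_basis e) (bar_map x) (P i) (t i))"
    and "\<bar>sig_coord e x m (P, \<pi>)\<bar> \<le> L ^ m / fact m ^ CARD('d)"
proof -
  let ?M = "Pi\<^sub>M {1..m} (\<lambda>_. lborel :: (real, 'd) vec measure)"
  let ?J = "\<lambda>t i. jac_minor (bar_basis e) (bar_map x) (P i) (t i)"
  note P = tensor_indicesD(1)[OF a] and \<pi> = tensor_indicesD(2)[OF a]
  have "AE t in ?M. t \<in> sig_domain m \<pi> \<longrightarrow>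
      (\<forall>i\<in>{1..m}. \<forall>Q\<in>W n. \<bar>jac_minor (bar_basis e) (bar_map x) Q (t i)\<bar> \<le> max (Linf_norm n (dhat e x)) 1)"
    by (rule AE_sig_domain[OF AE_bar_minor_le[OF x] \<pi>])
  then have "AE t in ?M. t \<in> sig_domain m \<pi> \<longrightarrow> \<bar>\<Prod>i\<in>{1..m}. ?J t i\<bar> \<le> L ^ m"
  proof eventually_elim
    case (elim t)
    show ?case
    proof
      assume "t \<in> sig_domain m \<pi>"
      then have "\<bar>?J t i\<bar> \<le> L" if "i \<in> {1..m}" for i
        using elim that P[OF that] L by fastforce
      then have "(\<Prod>i\<in>{1..m}. \<bar>?J t i\<bar>) \<le> (\<Prod>i\<in>{1..m}. L)"
        by (intro prod_mono) auto
      then show "\<bar>\<Prod>i\<in>{1..m}. ?J t i\<bar> \<le> L ^ m" by (simp add: abs_prod)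
    qed
  qed
  note * = set_integral_abs_le[OF sets_sig_domain[OF m \<pi>] borel_measurable_sig_integrand[OF x m \<pi>]
    this emeasure_sig_domain_le[OF m \<pi>]]
  show "set_integrable ?M (sig_domain m \<pi>) (\<lambda>t. \<Prod>i\<in>{1..m}. ?J t i)"
    using L by (intro *(1)) auto
  show "\<bar>sig_coord e x m (P, \<pi>)\<bar> \<le> L ^ m / fact m ^ CARD('d)"
    using L *(2) unfolding sig_coord_def prod.case by simp
qed

lemma sig_coord_diff_le:
  fixes x y :: "(real, 'd::{finite,linorder}) vec \<Rightarrow> 'v::real_inner"
  assumes x: "x \<in> Lip" and y: "y \<in> Lip" and m: "m \<ge> 1" and a: "(P, \<pi>) \<in> tensor_indices (W n) m"
    and Lx: "max (Linf_norm n (dhat e x)) 1 \<le> L" and Ly: "max (Linf_norm n (dhat e y)) 1 \<le> L"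
  shows "\<bar>sig_coord e x m (P, \<pi>) - sig_coord e y m (P, \<pi>)\<bar>
    \<le> real m * L ^ (m - 1) / fact m ^ CARD('d) * mu_rep e n x y"
proof -
  let ?M = "Pi\<^sub>M {1..m} (\<lambda>_. lborel :: (real, 'd) vec measure)"
  let ?J = "\<lambda>x t i. jac_minor (bar_basis e) (bar_map x) (P i) (t i)"
  let ?c = "real m * L ^ (m - 1) * mu_rep e n x y"
  note P = tensor_indicesD(1)[OF a] and \<pi> = tensor_indicesD(2)[OF a]
  note D = sets_sig_domain[OF m \<pi>]
  note int = sig_coord_le(1)[OF x m a Lx] sig_coord_le(1)[OF y m a Ly]
  have "AE t in ?M. t \<in> sig_domain m \<pi> \<longrightarrow>
      (\<forall>i\<in>{1..m}. \<forall>Q\<in>W n. \<bar>jac_minor (bar_basis e) (bar_map x) Q (t i)\<bar> \<le> max (Linf_norm n (dhat e x)) 1)"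
    "AE t in ?M. t \<in> sig_domain m \<pi> \<longrightarrow>
      (\<forall>i\<in>{1..m}. \<forall>Q\<in>W n. \<bar>jac_minor (bar_basis e) (bar_map y) Q (t i)\<bar> \<le> max (Linf_norm n (dhat e y)) 1)"
    "AE t in ?M. t \<in> sig_domain m \<pi> \<longrightarrow> (\<forall>i\<in>{1..m}. \<forall>Q\<in>W n.
      \<bar>jac_minor (bar_basis e) (bar_map x) Q (t i) - jac_minor (bar_basis e) (bar_map y) Q (t i)\<bar> \<le> mu_rep e n x y)"
    by (rule AE_sig_domain[OF AE_bar_minor_le[OF x] \<pi>] AE_sig_domain[OF AE_bar_minor_le[OF y] \<pi>]
        AE_sig_domain[OF AE_bar_minor_diff_le[OF x y] \<pi>])+
  then have bnd: "AE t in ?M. t \<in> sig_domain m \<pi> \<longrightarrow> \<bar>(\<Prod>i\<in>{1..m}. ?J x t i) - (\<Prod>i\<in>{1..m}. ?J y t i)\<bar> \<le> ?c"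
  proof eventually_elim
    case (elim t)
    show ?case
    proof
      assume t: "t \<in> sig_domain m \<pi>"
      have "\<bar>?J x t i\<bar> \<le> L" "\<bar>?J y t i\<bar> \<le> L" "\<bar>?J x t i - ?J y t i\<bar> \<le> mu_rep e n x y" if "i \<in> {1..m}" for i
        using elim t that P[OF that] Lx Ly by fastforce+
      then show "\<bar>(\<Prod>i\<in>{1..m}. ?J x t i) - (\<Prod>i\<in>{1..m}. ?J y t i)\<bar> \<le> ?c"
        using abs_prod_diff_le[of L "{1..m}" "?J x t" "?J y t" "mu_rep e n x y"] Lx by simp
    qed
  qed
  have "(\<lambda>t. indicator (sig_domain m \<pi>) t *\<^sub>R ((\<Prod>i\<in>{1..m}. ?J x t i) - (\<Prod>i\<in>{1..m}. ?J y t i))) \<in> borel_measurable ?M"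
    unfolding scaleR_diff_right
    by (intro borel_measurable_diff borel_measurable_sig_integrand x y m \<pi>)
  from set_integral_abs_le(2)[OF D this bnd emeasure_sig_domain_le[OF m \<pi>]]
  have "\<bar>set_lebesgue_integral ?M (sig_domain m \<pi>) (\<lambda>t. (\<Prod>i\<in>{1..m}. ?J x t i) - (\<Prod>i\<in>{1..m}. ?J y t i))\<bar>
      \<le> ?c * (1 / fact m ^ CARD('d))"
    using Lx mu_rep(1)[OF x y, where e = e and n = n] by simp
  then show ?thesis
    unfolding set_integral_diff(2)[OF int] by (simp add: sig_coord_def)
qed

section \<open>Summation over the levels\<close>

lemma tensor_indices_mono: "A \<subseteq> B \<Longrightarrow> tensor_indices A m \<subseteq> tensor_indices B m"
  by (auto simp: tensor_indices_def PiE_iff)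

lemma card_tensor_indices:
  "card (tensor_indices A m :: ('d::finite, 'f) tensor_index set) = card A ^ m * fact m ^ CARD('d)"
proof -
  have "{\<pi> :: 'd \<Rightarrow> nat \<Rightarrow> nat. \<forall>j. \<pi> j permutes {1..m}} = (UNIV \<rightarrow>\<^sub>E {\<sigma>. \<sigma> permutes {1..m}})"
    by auto
  then have "card {\<pi> :: 'd \<Rightarrow> nat \<Rightarrow> nat. \<forall>j. \<pi> j permutes {1..m}} = fact m ^ CARD('d)"
    by (simp add: card_PiE card_permutations)
  then show ?thesis
    unfolding tensor_indices_def card_cartesian_product by (simp add: card_PiE)
qed

text \<open>With \<open>r' = 0\<close> this proves membership in the Hilbert space, with two
  signatures it bounds their distance. Level \<open>m\<close> has
  \<open>card A ^ m * fact m ^ CARD('d)\<close> coordinates that may differ, so its squared norm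
  carries a single power \<open>fact m ^ CARD('d)\<close> in the denominator and is dominated by a
  term of an exponential series.\<close>

lemma hilb_dist_factorial_bound:
  fixes r r' :: "nat \<Rightarrow> ('d::finite, 'f) tensor_index \<Rightarrow> real"
  assumes "finite B" "A \<subseteq> B" "0 \<le> c"
    and out: "\<And>m a. a \<notin> tensor_indices A m \<Longrightarrow> r m a = r' m a"
    and bnd: "\<And>m a. a \<in> tensor_indices A m \<Longrightarrow> \<bar>r m a - r' m a\<bar> \<le> c * K ^ m / fact m ^ CARD('d)"
  shows "(\<lambda>m. (L2_set (\<lambda>a. r m a - r' m a) (tensor_indices B m))\<^sup>2) summable_on UNIV"
    and "hilb_dist B r r' \<le> c * sqrt (exp (real (card A) * K\<^sup>2))"
proof -
  let ?D = "\<lambda>m. (L2_set (\<lambda>a. r m a - r' m a) (tensor_indices B m))\<^sup>2"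
  let ?e = "\<lambda>m. (real (card A) * K\<^sup>2) ^ m / fact m"
  have level: "?D m \<le> c\<^sup>2 * ?e m" for m
  proof -
    define F :: real where "F = fact m ^ CARD('d)"
    \<comment> \<open>This is where the dimension being at least 1 enters: a positive power of
      \<open>fact m\<close> is at least \<open>fact m\<close>.\<close>
    have F: "fact m \<le> F" "0 < F"
      unfolding F_def by (auto intro!: self_le_power)
    have "tensor_indices A m \<subseteq> (tensor_indices B m :: ('d, 'f) tensor_index set)"
      using assms(2) by (rule tensor_indices_mono)
    then have "?D m = (\<Sum>a\<in>tensor_indices A m. (r m a - r' m a)\<^sup>2)"
      unfolding L2_set_def using finite_tensor_indices[OF assms(1)] out
      by (subst real_sqrt_pow2) (auto intro!: sum_nonneg sum.mono_neutral_right)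
    also have "\<dots> \<le> (\<Sum>a\<in>(tensor_indices A m :: ('d, 'f) tensor_index set). (c * K ^ m / F)\<^sup>2)"
      using bnd unfolding F_def by (intro sum_mono) (metis abs_ge_zero power2_abs power_mono)
    also have "\<dots> = real (card A) ^ m * F * (c * K ^ m / F)\<^sup>2"
      by (simp add: card_tensor_indices F_def)
    also have "\<dots> = c\<^sup>2 * (real (card A) * K\<^sup>2) ^ m / F"
      using F(2) by (simp add: power_mult_distrib power_divide power2_eq_square field_simps flip: power_mult)
    also have "\<dots> \<le> c\<^sup>2 * (real (card A) * K\<^sup>2) ^ m / fact m"
      using F by (intro divide_left_mono) auto
    finally show ?thesis by simp
  qed
  have sums: "?e sums exp (real (card A) * K\<^sup>2)"
    using exp_converges[of "real (card A) * K\<^sup>2"] by (simp add: divide_inverse mult.commute)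
  have "L2_set (\<lambda>m. L2_set (\<lambda>a. r m a - r' m a) (tensor_indices B m)) {..<N} \<le> c * sqrt (exp (real (card A) * K\<^sup>2))" for N
  proof -
    have "(\<Sum>m<N. ?D m) \<le> c\<^sup>2 * (\<Sum>m<N. ?e m)"
      unfolding sum_distrib_left by (intro sum_mono level)
    also have "\<dots> \<le> c\<^sup>2 * exp (real (card A) * K\<^sup>2)"
      using sum_le_suminf[of ?e "{..<N}"] sums
      by (intro mult_left_mono) (auto simp: sums_iff)
    finally show ?thesis
      unfolding L2_set_def[of _ "{..<N}"] using assms(3)
      by (intro real_le_lsqrt) (simp_all add: power_mult_distrib)
  qed
  note hilb_dist_le[OF this]
  then show "(\<lambda>m. (L2_set (\<lambda>a. r m a - r' m a) (tensor_indices B m))\<^sup>2) summable_on UNIV"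
    and "hilb_dist B r r' \<le> c * sqrt (exp (real (card A) * K\<^sup>2))" .
qed

lemma bar_sig_hilb:
  fixes x :: "real^'d::{finite,linorder} \<Rightarrow> 'v::real_inner"
  assumes "x \<in> Lip"
  shows "bar_sig e n x \<in> hilb (bar_forms n)"
proof -
  define L where "L = max (Linf_norm n (dhat e x)) 1"
  \<comment> \<open>The signature is compared with the zero element. At level 0 the bound equals 1,
    which is the value of the only coordinate there.\<close>
  have "\<bar>bar_sig e n x m a - 0\<bar> \<le> 1 * L ^ m / fact m ^ CARD('d)" if "a \<in> tensor_indices (W n) m" for m a
  proof (cases "m = 0")
    case False
    with that show ?thesis
      using sig_coord_le(2)[OF assms, where m = m and n = n and e = e and L = L and P = "fst a" and \<pi> = "snd a"]
      by (simp add: bar_sig_def L_def)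
  qed (use that in \<open>simp add: bar_sig_def\<close>)
  then have "(\<lambda>m. (L2_set (\<lambda>a. bar_sig e n x m a - 0) (tensor_indices (bar_forms n) m))\<^sup>2) summable_on UNIV"
    by (intro hilb_dist_factorial_bound(1)[OF finite_bar_forms W_subset_bar_forms, where c = 1 and K = L])
      (simp_all add: bar_sig_def)
  then have "(\<lambda>m. (L2_set (bar_sig e n x m) (tensor_indices (bar_forms n) m))\<^sup>2) summable_on UNIV"
    by (simp only: diff_zero)
  moreover have "bar_sig e n x m a = 0" if "a \<notin> tensor_indices (bar_forms n) m" for m a
    using that tensor_indices_mono[OF W_subset_bar_forms] by (auto simp: bar_sig_def)
  ultimately show ?thesis
    by (simp add: hilb_def tensors_def)
qed

text \<open>The factor of the distance depends on the maps only through \<open>L\<close>, so the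
  signature is Lipschitz on every set of classes with bounded norm.\<close>

lemma hilb_dist_bar_sig_le:
  fixes x y :: "(real, 'd::{finite,linorder}) vec \<Rightarrow> 'v::real_inner"
  assumes x: "x \<in> Lip" and y: "y \<in> Lip"
    and Lx: "max (Linf_norm n (dhat e x)) 1 \<le> L" and Ly: "max (Linf_norm n (dhat e y)) 1 \<le> L"
  shows "hilb_dist (bar_forms n) (bar_sig e n x) (bar_sig e n y)
    \<le> mu_rep e n x y * sqrt (exp (real (card (W n :: ('d \<Rightarrow> 'd + nat) set)) * (2 * L)\<^sup>2))"
proof (rule hilb_dist_factorial_bound(2)[OF finite_bar_forms W_subset_bar_forms])
  show mu: "0 \<le> mu_rep e n x y" by (rule mu_rep(1)[OF x y])
  fix m and a :: "('d, 'd \<Rightarrow> 'd + nat) tensor_index"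
  show "a \<notin> tensor_indices (W n) m \<Longrightarrow> bar_sig e n x m a = bar_sig e n y m a"
    by (simp add: bar_sig_def)
  assume a: "a \<in> tensor_indices (W n) m"
  show "\<bar>bar_sig e n x m a - bar_sig e n y m a\<bar> \<le> mu_rep e n x y * (2 * L) ^ m / fact m ^ CARD('d)"
  proof (cases "m = 0")
    case False
    \<comment> \<open>\<open>m \<le> 2\<^sup>m\<close> absorbs the factor \<open>m\<close>, so that the levels sum to an exponential series.\<close>
    have "real m * L ^ (m - 1) \<le> 2 ^ m * L ^ m"
      using Lx by (intro mult_mono power_increasing) (auto simp: less_imp_le)
    then have "real m * L ^ (m - 1) / fact m ^ CARD('d) * mu_rep e n x y \<le> (2 * L) ^ m / fact m ^ CARD('d) * mu_rep e n x y"
      using mu by (intro mult_right_mono divide_right_mono) (simp_all add: power_mult_distrib)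
    moreover have "\<bar>sig_coord e x m a - sig_coord e y m a\<bar> \<le> real m * L ^ (m - 1) / fact m ^ CARD('d) * mu_rep e n x y"
      using sig_coord_diff_le[OF x y _ _ Lx Ly, of m "fst a" "snd a"] a False by simp
    ultimately show ?thesis
      using a False by (simp add: bar_sig_def mult_ac)
  qed (use a mu in \<open>simp add: bar_sig_def\<close>)
qed

text \<open>This triangle inequality bounds the norms of all maps near \<open>x\<close>, which
  provides a common \<open>L\<close> on a neighbourhood.\<close>

lemma Linf_norm_le_add_mu:
  fixes x y :: "(real, 'd::{finite,linorder}) vec \<Rightarrow> 'v::real_inner"
  assumes "x \<in> Lip" "y \<in> Lip"
  shows "Linf_norm n (dhat e y) \<le> Linf_norm n (dhat e x) + mu_rep e n x y"
proof (rule norm_rep(3)[OF assms(2) assms(2)])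
  show "AE s in lebesgue_on (cbox 0 1). L2_set (dhat e y s) (ord_inj n) \<le> Linf_norm n (dhat e x) + mu_rep e n x y"
    using norm_rep(2)[OF assms(1) assms(1), where e = e and n = n] mu_rep(2)[OF assms, where e = e and n = n]
  proof eventually_elim
    case (elim s)
    then show ?case
      using L2_set_diff_triangle[of "dhat e y s" "\<lambda>_. 0" "ord_inj n" "dhat e x s"]
        L2_set_diff_commute[of "dhat e x s" "dhat e y s" "ord_inj n"] by simp
  qed
qed

section \<open>Passage to Jacobian equivalence classes\<close>

lemma continuous_map_bar_Phi:
  fixes e :: "nat \<Rightarrow> 'v::real_inner"
  shows "continuous_map
       (Metric_space.mtopology (LipJ e n :: (real^'d::{finite,linorder} \<Rightarrow> 'v) set set) (mu_inf e n))
       (Metric_space.mtopology (hilb (bar_forms n)) (hilb_dist (bar_forms n)))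
       (bar_Phi e n)"
  unfolding Metric_space.metric_continuous_map[OF Metric_space_LipJ Metric_space_hilb[OF finite_bar_forms]]
proof (intro conjI ballI allI impI image_subsetI)
  fix X :: "((real, 'd) vec \<Rightarrow> 'v) set" assume X: "X \<in> LipJ e n"
  then obtain x where x: "x \<in> Lip" "x \<in> X" using LipJ_nonempty by blast
  show "bar_Phi e n X \<in> hilb (bar_forms n)"
    unfolding bar_Phi_eq[OF X x(2)] by (rule bar_sig_hilb[OF x(1)])
  fix \<epsilon> :: real assume "\<epsilon> > 0"
  \<comment> \<open>The summand 1 is the radius of a ball around \<open>X\<close>: for
    \<open>\<delta>\<close> at most 1, this \<open>L\<close> also bounds the norm of every class
    \<open>Y\<close> in question, and \<open>C\<close> is then a Lipschitz constant valid for all of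
    them.\<close>
  define L where "L = max (Linf_norm n (dhat e x)) 1 + 1"
  define C where "C = sqrt (exp (real (card (W n :: ('d \<Rightarrow> 'd + nat) set)) * (2 * L)\<^sup>2))"
  have "C > 0" by (simp add: C_def)
  show "\<exists>\<delta>>0. \<forall>Y. Y \<in> LipJ e n \<and> mu_inf e n X Y < \<delta> \<longrightarrow>
      hilb_dist (bar_forms n) (bar_Phi e n X) (bar_Phi e n Y) < \<epsilon>"
  proof (intro exI[of _ "min 1 (\<epsilon> / C)"] conjI allI impI; (elim conjE)?)
    show "0 < min 1 (\<epsilon> / C)" using \<open>\<epsilon> > 0\<close> \<open>C > 0\<close> by simp
    fix Y assume Y: "Y \<in> LipJ e n" and less: "mu_inf e n X Y < min 1 (\<epsilon> / C)"
    then obtain y where y: "y \<in> Lip" "y \<in> Y" using LipJ_nonempty by blast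
    have mu: "mu_rep e n x y < 1" "mu_rep e n x y < \<epsilon> / C"
      using less mu_inf_eq[OF X Y x(2) y(2)] by simp_all
    have "hilb_dist (bar_forms n) (bar_sig e n x) (bar_sig e n y) \<le> mu_rep e n x y * C"
      unfolding C_def using Linf_norm_le_add_mu[OF x(1) y(1), of n e] mu(1)
      by (intro hilb_dist_bar_sig_le x(1) y(1)) (auto simp: L_def)
    also have "\<dots> < \<epsilon>"
      using mu(2) \<open>C > 0\<close> by (simp add: pos_less_divide_eq)
    finally show "hilb_dist (bar_forms n) (bar_Phi e n X) (bar_Phi e n Y) < \<epsilon>"
      unfolding bar_Phi_eq[OF X x(2)] bar_Phi_eq[OF Y y(2)] .
  qed
qed

theorem proposition8:
  fixes e :: "nat \<Rightarrow> 'v::real_inner" and n :: nat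
  assumes "orthonormal_basis e n"
  shows
    "continuous_map
       (Metric_space.mtopology (LipJ e n :: (real^'d::{finite,linorder} \<Rightarrow> 'v) set set) (mu_inf e n))
       (Metric_space.mtopology (hilb (bar_forms n)) (hilb_dist (bar_forms n)))
       (bar_Phi e n) \<and>
     (\<forall>X \<in> LipJ e n :: ((real, 'd) vec \<Rightarrow> 'v) set set. \<forall>Y \<in> LipJ e n. \<forall>L \<epsilon>.
        L > max (max (dhat_norm e n X) (dhat_norm e n Y)) 1 \<longrightarrow> \<epsilon> > mu_inf e n X Y \<longrightarrow>
        (\<forall>m\<ge>1. \<forall>(P, \<pi>) \<in> tensor_indices (W n) m.
           \<bar>bar_Phi e n X m (P, \<pi>) - bar_Phi e n Y m (P, \<pi>)\<bar>
             < real m * L ^ (m - 1) / fact m ^ CARD('d) * \<epsilon>))"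
proof (intro conjI continuous_map_bar_Phi ballI allI impI, clarify)
  fix X Y :: "((real, 'd) vec \<Rightarrow> 'v) set" and L \<epsilon> :: real and m :: nat and P :: "nat \<Rightarrow> 'd \<Rightarrow> 'd + nat" and \<pi> :: "'d \<Rightarrow> nat \<Rightarrow> nat"
  assume X: "X \<in> LipJ e n" and Y: "Y \<in> LipJ e n"
    and L: "L > max (max (dhat_norm e n X) (dhat_norm e n Y)) 1" and \<epsilon>: "\<epsilon> > mu_inf e n X Y"
    and m: "m \<ge> 1" and a: "(P, \<pi>) \<in> tensor_indices (W n) m"
  obtain x y where x: "x \<in> Lip" "x \<in> X" and y: "y \<in> Lip" "y \<in> Y"
    using LipJ_nonempty[OF X] LipJ_nonempty[OF Y] by blast
  have "\<bar>sig_coord e x m (P, \<pi>) - sig_coord e y m (P, \<pi>)\<bar>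
      \<le> real m * L ^ (m - 1) / fact m ^ CARD('d) * mu_rep e n x y"
    using L unfolding dhat_norm_eq[OF X x(2)] dhat_norm_eq[OF Y y(2)]
    by (intro sig_coord_diff_le x(1) y(1) m a) auto
  \<comment> \<open>The strict inequality comes from \<open>\<epsilon>\<close> exceeding the
    distance; the factor in front is positive because \<open>m \<ge> 1\<close> and
    \<open>L > 1\<close>.\<close>
  also have "\<dots> < real m * L ^ (m - 1) / fact m ^ CARD('d) * \<epsilon>"
    using \<epsilon> L m unfolding mu_inf_eq[OF X Y x(2) y(2)] by (intro mult_strict_left_mono) simp_all
  finally show "\<bar>bar_Phi e n X m (P, \<pi>) - bar_Phi e n Y m (P, \<pi>)\<bar>
      < real m * L ^ (m - 1) / fact m ^ CARD('d) * \<epsilon>"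
    using m a unfolding bar_Phi_eq[OF X x(2)] bar_Phi_eq[OF Y y(2)] by (simp add: bar_sig_def)
qed

end
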